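(* Let $g_1(t),g_2(t)$, $t\in\mathbb{R}$, be two smooth families of non-trapping Riemannian metrics on $\mathbb{R}^n$, each a compactly supported (in spacetime) perturbation of the flat metric, with $g_i(t)=g_0$ if $|z|\ge R$ or $|t|\ge T$. Suppose that the classical scattering maps $\mathfrak{Cl}_{g_1}$ and $\mathfrak{Cl}_{g_2}$ have the same restriction to $\overline{{}^{\mathrm{1c}}T^*_{\partial\overline{\mathbb{R}^n}}\mathbb{R}^n}$. Then their $R$-truncated scattering relations coincide: $\mathfrak{Cl}_{g_1}^R=\mathfrak{Cl}_{g_2}^R$.
   Context: Non-trapping: for each $t$, the geodesics of $g(t)$ leave every compact set in finite time. $g_0=\sum dz_i^2$; $(z,t)$ are coordinates on $\mathbb{R}^n\times\mathbb{R}$, with dual variables $(\zeta,\tau)$. 1-cusp cotangent bundle: $\overline{\mathbb{R}^n}$ is the radial compactification of $\mathbb{R}^n_Z$, with boundary defining function $x=1/|Z|$ near infinity and $y=Z/|Z|\in\mathbb{S}^{n-1}$. The 1-cusp cotangent bundle ${}^{\mathrm{1c}}T^*\mathbb{R}^n$ over $\overline{\mathbb{R}^n}$ is $T^*\mathbb{R}^n$ in the interior and near the boundary has fibre coordinates $(\xi,\eta)$ defined by writing covectors as $\xi\frac{dx}{x^3}+\eta\cdot\frac{dy}{x}$; thus a covector $Z^*\cdot dZ$ has $\xi=-x\,Z^*\cdot y$ and $\eta=$ the component of $Z^*$ orthogonal to $y$. The bar denotes radial compactification of the fibres, and the subscript $\partial\overline{\mathbb{R}^n}$ denotes restriction to $\{x=0\}$.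 Classical scattering map: for $(Z_-,Z_-^* )\in T^*\mathbb{R}^n$ there is a unique bicharacteristic of $p=\tau+\sum g^{ij}(z,t)\zeta_i\zeta_j$ in $\{p=0\}$ which for $t\ll0$ is $\zeta=Z_-$, $z=2tZ_--Z_-^*$; for $t\gg0$ it has the form $\zeta=Z_+$, $z=2tZ_+-Z_+^*$, and $\mathfrak{Cl}_g(Z_-,Z_-^* )=(Z_+,Z_+^* )$. This extends smoothly to a map $\mathfrak{Cl}_g:\overline{{}^{\mathrm{1c}}T^*\mathbb{R}^n}\to\overline{{}^{\mathrm{1c}}T^*\mathbb{R}^n}$. Over $\partial\overline{\mathbb{R}^n}$, at finite 1-cusp frequency, it is given by $(y,\xi,\eta)\mapsto(y',\xi,\eta')$, where the unit speed geodesic of $g(t)$, $t=-\xi/2$, which in the far past runs along the line $\{-\eta+sy\}$ in the direction $y$, runs in the far future along the line $\{-\eta'+sy'\}$ in the direction $y'$ (with $\eta\perp y$, $\eta'\perp y'$). Truncated scattering relation: let $\partial_\mp\mathfrak{B}$ be the set of $(t,z,v)$ with $t\in[-T,T]$, $z\in\partial B_R(0)$, $v$ a unit covector at $z$ pointing inward ($-$) resp. outward ($+$) with respect to $B_R(0)$. $\mathfrak{Cl}^R_{g_i}:\partial_-\mathfrak{B}\to\partial_+\mathfrak{B}$, $(t,z,v)\mapsto(t,z',v')$, where $(z',v')$ is the position and direction at which the unit speed $g_i(t)$-geodesic (lifted to the cosphere bundle) starting from $(z,v)$ first exits $B_R(0)$. *)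

theory Defs
  imports "HOL-Analysis.Analysis"
begin

section \<open>Families of Riemannian metrics\<close>

primrec times_differentiable ::
  "nat \<Rightarrow> ('a::real_normed_vector \<Rightarrow> 'b::real_normed_vector) \<Rightarrow> bool" where
  "times_differentiable 0 f \<longleftrightarrow> continuous_on UNIV f"
| "times_differentiable (Suc k) f \<longleftrightarrow>
     (\<forall>x. f differentiable (at x)) \<and>
     (\<forall>v. times_differentiable k (\<lambda>x. frechet_derivative f (at x) v))"

definition smooth :: "('a::real_normed_vector \<Rightarrow> 'b::real_normed_vector) \<Rightarrow> bool" where
  "smooth f \<longleftrightarrow> (\<forall>k. times_differentiable k f)"

text \<open>A metric on $\mathbb{R}^n$ is given by its matrix $(g_{ij}(z))$ in the standard
  coordinates; a family $g(t)$ of metrics is a function of $t$ and $z$, smooth in $(t,z)$ jointly.\<close>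

type_synonym 'n metric = "real ^ 'n \<Rightarrow> real ^ 'n ^ 'n"

definition riemannian :: "'n::finite metric \<Rightarrow> bool" where
  "riemannian G \<longleftrightarrow>
     (\<forall>z. transpose (G z) = G z \<and> (\<forall>v. v \<noteq> 0 \<longrightarrow> v \<bullet> (G z *v v) > 0))"

definition smooth_metric_family :: "(real \<Rightarrow> 'n::finite metric) \<Rightarrow> bool" where
  "smooth_metric_family g \<longleftrightarrow> smooth (\<lambda>(t, z). g t z) \<and> (\<forall>t. riemannian (g t))"

definition flat_outside :: "(real \<Rightarrow> 'n::finite metric) \<Rightarrow> real \<Rightarrow> real \<Rightarrow> bool" where
  "flat_outside g R T \<longleftrightarrow> (\<forall>t z. norm z \<ge> R \<or> \<bar>t\<bar> \<ge> T \<longrightarrow> g t z = mat 1)"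

section \<open>Geodesics\<close>

definition metric_deriv :: "'n::finite metric \<Rightarrow> real ^ 'n \<Rightarrow> 'n \<Rightarrow> 'n \<Rightarrow> 'n \<Rightarrow> real" where
  "metric_deriv G z i j l = frechet_derivative (\<lambda>w. G w $ j $ l) (at z) (axis i 1)"

text \<open>The Christoffel symbol $\Gamma^k_{ij}$ of the Levi-Civita connection.\<close>

definition christoffel :: "'n::finite metric \<Rightarrow> real ^ 'n \<Rightarrow> 'n \<Rightarrow> 'n \<Rightarrow> 'n \<Rightarrow> real" where
  "christoffel G z k i j = (1/2) * (\<Sum>l\<in>UNIV. matrix_inv (G z) $ k $ l *
     (metric_deriv G z i j l + metric_deriv G z j i l - metric_deriv G z l i j))"

text \<open>\<open>c\<close> is an affinely parametrized geodesic with velocity \<open>v\<close>.  The metrics considered here are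
  flat outside a compact set, hence complete, so that maximal geodesics are defined on all of
  $\mathbb{R}$.\<close>

definition geodesic ::
  "'n::finite metric \<Rightarrow> (real \<Rightarrow> real ^ 'n) \<Rightarrow> (real \<Rightarrow> real ^ 'n) \<Rightarrow> bool" where
  "geodesic G c v \<longleftrightarrow> (\<forall>s.
     (c has_vector_derivative v s) (at s) \<and>
     (v has_vector_derivative
        (\<chi> k. - (\<Sum>i\<in>UNIV. \<Sum>j\<in>UNIV. christoffel G (c s) k i j * v s $ i * v s $ j))) (at s))"

text \<open>\<open>at_infinity\<close> on the real line means that the parameter tends to $+\infty$ or $-\infty$.\<close>

definition nontrapping :: "'n::finite metric \<Rightarrow> bool" where
  "nontrapping G \<longleftrightarrow>
     (\<forall>c v K. geodesic G c v \<and> (\<exists>s. v s \<noteq> 0) \<and> compact K \<longrightarrow>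
        (\<forall>\<^sub>F s in at_infinity. c s \<notin> K))"

section \<open>Bicharacteristics and the classical scattering map\<close>

text \<open>Hamilton's equations: position \<open>q\<close>, dual variable \<open>\<theta>\<close>.\<close>

definition hamilton_curve ::
  "('a::real_inner \<Rightarrow> 'a \<Rightarrow> real) \<Rightarrow> (real \<Rightarrow> 'a) \<Rightarrow> (real \<Rightarrow> 'a) \<Rightarrow> bool" where
  "hamilton_curve p q \<theta> \<longleftrightarrow> (\<forall>s. \<exists>u w.
     GDERIV (\<lambda>\<theta>'. p (q s) \<theta>') (\<theta> s) :> u \<and>
     GDERIV (\<lambda>q'. p q' (\<theta> s)) (q s) :> w \<and>
     (q has_vector_derivative u) (at s) \<and>
     (\<theta> has_vector_derivative - w) (at s))"

text \<open>$p = \tau + \sum g^{ij}(z,t)\zeta_i\zeta_j$ on $T^*(\mathbb{R}\times\mathbb{R}^n)$.\<close>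

definition symbol ::
  "(real \<Rightarrow> 'n::finite metric) \<Rightarrow> real \<times> (real ^ 'n) \<Rightarrow> real \<times> (real ^ 'n) \<Rightarrow> real" where
  "symbol g = (\<lambda>(t, z) (\<tau>, \<zeta>). \<tau> + \<zeta> \<bullet> (matrix_inv (g t z) *v \<zeta>))"

definition scatters ::
  "(real \<Rightarrow> 'n::finite metric) \<Rightarrow> (real ^ 'n) \<times> (real ^ 'n) \<Rightarrow> (real ^ 'n) \<times> (real ^ 'n) \<Rightarrow> bool" where
  "scatters g = (\<lambda>(Zm, Zm') (Zp, Zp'). \<exists>t z \<tau> \<zeta>.
     hamilton_curve (symbol g) (\<lambda>s. (t s, z s)) (\<lambda>s. (\<tau> s, \<zeta> s)) \<and>
     (\<forall>s. symbol g (t s, z s) (\<tau> s, \<zeta> s) = 0) \<and>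
     (\<exists>a. \<forall>s. t s \<le> a \<longrightarrow> \<zeta> s = Zm \<and> z s = (2 * t s) *\<^sub>R Zm - Zm') \<and>
     (\<exists>b. \<forall>s. t s \<ge> b \<longrightarrow> \<zeta> s = Zp \<and> z s = (2 * t s) *\<^sub>R Zp - Zp'))"

definition classical_map ::
  "(real \<Rightarrow> 'n::finite metric) \<Rightarrow> (real ^ 'n) \<times> (real ^ 'n) \<Rightarrow> (real ^ 'n) \<times> (real ^ 'n)" where
  "classical_map g q = (THE q'. scatters g q q')"

section \<open>The compactified 1-cusp cotangent bundle\<close>

definition bracket :: "'a::real_inner \<Rightarrow> real" where
  "bracket Z = sqrt (1 + (norm Z)\<^sup>2)"

text \<open>The radial compactification is realized as the closed unit ball; the boundary point
  approached in the direction $y$ is the point $y$ of the unit sphere.\<close>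

definition radial :: "'a::real_inner \<Rightarrow> 'a" where
  "radial Z = Z /\<^sub>R bracket Z"

text \<open>Coordinates of a covector \<open>Z'\<close> at \<open>Z\<close> with respect to a global frame of the 1-cusp cotangent
  bundle, smooth up to the boundary: the component orthogonal to \<open>Z\<close> is kept and the
  component along \<open>Z\<close> is divided by \<open>bracket Z\<close>.  The lemma below compares this with the
  fibre coordinates $(\xi,\eta)$: with $x = 1/|Z|$, $y = Z/|Z|$ the value is
  $\eta - (1+x^2)^{-1/2}\,\xi y$.  So over a boundary point $y$ the fibre coordinate is
  $\eta - \xi y$ (with $\eta \perp y$).\<close>

definition onec_coord :: "'a::real_inner \<Rightarrow> 'a \<Rightarrow> 'a" where
  "onec_coord Z Z' = Z' - ((Z \<bullet> Z') / (bracket Z * (1 + bracket Z))) *\<^sub>R Z"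

lemma onec_coord_polar:
  fixes Z Z' :: "'a::real_inner"
  assumes "Z \<noteq> 0"
  defines "x \<equiv> 1 / norm Z" and "y \<equiv> Z /\<^sub>R norm Z"
  defines "\<xi> \<equiv> - x * (Z' \<bullet> y)" and "\<eta> \<equiv> Z' - (Z' \<bullet> y) *\<^sub>R y"
  shows "onec_coord Z Z' = \<eta> - (\<xi> / sqrt (1 + x\<^sup>2)) *\<^sub>R y"
proof -
  define r where "r = norm Z"
  define b where "b = bracket Z"
  have r: "r > 0" using assms(1) by (simp add: r_def)
  have b2: "b\<^sup>2 = 1 + r\<^sup>2" and b: "b > 0"
    by (simp_all add: b_def bracket_def r_def add_pos_nonneg)
  have sq: "sqrt (1 + x\<^sup>2) = b / r"
  proof (rule real_sqrt_unique)
    show "(b / r)\<^sup>2 = 1 + x\<^sup>2"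
      using r b2 by (simp add: x_def r_def[symmetric] power_divide field_simps)
  qed (use r b in simp)
  have Z: "Z = r *\<^sub>R y" using r by (simp add: y_def r_def)
  have eq: "r\<^sup>2 / (b * (1 + b)) = 1 - 1 / b"
  proof -
    have "r\<^sup>2 = (b - 1) * (1 + b)" using b2 by (simp add: algebra_simps power2_eq_square)
    then have "r\<^sup>2 / (b * (1 + b)) = (b - 1) / b" using b by simp
    then show ?thesis using b by (simp add: diff_divide_distrib)
  qed
  have "onec_coord Z Z' = Z' - ((Z' \<bullet> y) * (r\<^sup>2 / (b * (1 + b)))) *\<^sub>R y"
    unfolding onec_coord_def b_def[symmetric]
    by (subst (1 2) Z) (simp add: inner_commute power2_eq_square mult_ac)
  also have "\<dots> = \<eta> + ((Z' \<bullet> y) / b) *\<^sub>R y"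
    unfolding eq by (simp add: \<eta>_def algebra_simps)
  also have "(Z' \<bullet> y) / b = - (\<xi> / sqrt (1 + x\<^sup>2))"
    unfolding sq \<xi>_def using r b by (simp add: x_def r_def[symmetric])
  finally show ?thesis by simp
qed

text \<open>The total space of the bundle with radially compactified base and fibres is realized as
  \<open>cball 0 1 \<times> cball 0 1\<close>, with $T^*\mathbb{R}^n$ embedded as the product of the open balls.\<close>

definition onec_embed :: "'a::real_inner \<times> 'a \<Rightarrow> 'a \<times> 'a" where
  "onec_embed = (\<lambda>(Z, Z'). (radial Z, radial (onec_coord Z Z')))"

definition onec_bundle :: "('a::real_inner \<times> 'a) set" where
  "onec_bundle = cball 0 1 \<times> cball 0 1"

definition onec_boundary :: "('a::real_inner \<times> 'a) set" where
  "onec_boundary = {b \<in> onec_bundle. norm (fst b) = 1}"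

text \<open>The extension of the classical scattering map to the compactified bundle, by
  continuity: its value at \<open>b\<close> is the limit of the embedded \<open>classical_map g q\<close> as the
  embedded point \<open>q\<close> tends to \<open>b\<close>.\<close>

definition classical_map_ext ::
  "(real \<Rightarrow> 'n::finite metric) \<Rightarrow> (real ^ 'n) \<times> (real ^ 'n) \<Rightarrow> (real ^ 'n) \<times> (real ^ 'n)" where
  "classical_map_ext g b =
     Lim (filtercomap onec_embed (nhds b)) (\<lambda>q. onec_embed (classical_map g q))"

section \<open>The truncated scattering relation\<close>

text \<open>On $|z| = R$ the metrics are flat, so unit covectors are those of Euclidean norm 1.\<close>

definition boundary_in :: "real \<Rightarrow> real \<Rightarrow> (real \<times> (real ^ 'n::finite) \<times> (real ^ 'n)) set" where
  "boundary_in R T = {(t, z, v). t \<in> {-T..T} \<and> norm z = R \<and> norm v = 1 \<and> v \<bullet> z < 0}"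

definition boundary_out :: "real \<Rightarrow> real \<Rightarrow> (real \<times> (real ^ 'n::finite) \<times> (real ^ 'n)) set" where
  "boundary_out R T = {(t, z, v). t \<in> {-T..T} \<and> norm z = R \<and> norm v = 1 \<and> v \<bullet> z > 0}"

text \<open>The graph of the map from \<open>boundary_in R T\<close> to \<open>boundary_out R T\<close>.  The covector
  of a geodesic is obtained from its velocity by lowering the index with \<open>g t\<close>.\<close>

definition truncated_scattering ::
  "(real \<Rightarrow> 'n::finite metric) \<Rightarrow> real \<Rightarrow> real \<Rightarrow>
     ((real \<times> (real ^ 'n) \<times> (real ^ 'n)) \<times> (real \<times> (real ^ 'n) \<times> (real ^ 'n))) set" where
  "truncated_scattering g R T =
     {((t, z, v), (t', z', v')). (t, z, v) \<in> boundary_in R T \<and> (t', z', v') \<in> boundary_out R T \<and>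
        t' = t \<and>
        (\<exists>c u s. geodesic (g t) c u \<and> c 0 = z \<and> g t z *v u 0 = v \<and>
           s > 0 \<and> (\<forall>r\<in>{0<..<s}. c r \<in> ball 0 R) \<and> c s \<notin> ball 0 R \<and>
           c s = z' \<and> g t z' *v u s = v')}"

end

theory Submission
  imports Defs
begin

text \<open>
  For covectors tending to a finite point $(v, \xi, \eta)$ over the boundary at infinity, the
  bicharacteristics, run with time rescaled by the inverse frequency \<open>h\<close>, satisfy a system that depends
  Lipschitz continuously on \<open>h\<close> down to \<open>h = 0\<close>, where it is the geodesic flow of $g(t)$ at the frozen
  time $t = -\xi/2$.  Since all curves are straight outside $B_R$, only a compact time interval
  matters, and continuous dependence on initial data identifies the boundary value of the scattering
  map with the pair of asymptotic lines of a $g(t)$-geodesic.  These lines determine where the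
  geodesic enters and leaves $B_R$; non-trapping provides the exit point.
\<close>

section \<open>Lipschitz differential equations\<close>

text \<open>In the rescaled variables the vector field is quadratic in the covector, hence not
  globally Lipschitz, and for h > 0 the energy is in general not conserved because the metric
  depends on time. Both obstacles are met by projecting the covector onto a ball of radius
  \<open>M\<close>: the projected field is globally Lipschitz, its solutions exist on the whole
  line, and for h = 0 conservation of energy shows that the projection does nothing once
  \<open>M\<close> is large. The scaling comes from the incoming line: if Z = y/h and Z' = \<eta> +
  (2 t1/h) y with \<eta> orthogonal to the unit vector y, then 2tZ - Z' = -\<eta> + \<sigma> y with
  \<sigma> = 2(t - t1)/h, and t1 = h (Z' \<bullet> y)/2 is -\<xi>/2. Two definitions demand extra
  arguments: \<open>classical_map\<close> is a definite description, so bicharacteristics must be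
  shown unique, and \<open>classical_map_ext\<close> is a limit along a filter that must be shown
  proper.\<close>

lemma signed_integral_has_vector_derivative:
  fixes f :: "real \<Rightarrow> 'a::euclidean_space"
  assumes "continuous_on UNIV f"
  defines "G \<equiv> \<lambda>t. integral {0..t} f - integral {t..0} f"
  shows "(G has_vector_derivative f t) (at t)"
proof -
  have int: "f integrable_on {a..b}" for a b
    by (rule integrable_continuous_interval) (rule continuous_on_subset[OF assms(1)], simp)
  define N where "N = \<bar>t\<bar> + 1"
  have N: "-N < t" "t < N" "-N < 0" "0 < N" by (auto simp: N_def)
  \<comment> \<open>Integrals over reversed intervals vanish, so \<open>G\<close> is the integral
    oriented from 0 to s. Near t it differs by a constant from the integral based at -N, and t is
    interior to {-N..N}.\<close>
  have eq: "G s = integral {-N..s} f - integral {-N..0} f" if "s \<in> {-N<..<N}" for s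
  proof (cases "s \<ge> 0")
    case True
    have "integral {-N..0} f + integral {0..s} f = integral {-N..s} f"
      by (rule Henstock_Kurzweil_Integration.integral_combine) (use that True N int in auto)
    moreover have "integral {s..0} f = 0"
      using True by (cases "s = 0") auto
    ultimately show ?thesis by (simp add: G_def algebra_simps)
  next
    case False
    have "integral {-N..s} f + integral {s..0} f = integral {-N..0} f"
      by (rule Henstock_Kurzweil_Integration.integral_combine) (use that False N int in auto)
    with False show ?thesis by (simp add: G_def algebra_simps)
  qed
  have "((\<lambda>u. integral {-N..u} f) has_vector_derivative f t) (at t within {-N..N})"
    by (rule integral_has_vector_derivative) (use N continuous_on_subset[OF assms(1)] in auto)
  then have "((\<lambda>u. integral {-N..u} f) has_vector_derivative f t) (at t)"
    using N by (simp add: at_within_Icc_at)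
  then have "((\<lambda>u. integral {-N..u} f - integral {-N..0} f) has_vector_derivative f t) (at t)"
    by (auto intro!: derivative_eq_intros)
  then show ?thesis
    by (rule has_vector_derivative_transform_within_open[where S = "{-N<..<N}"])
       (use N eq in auto)
qed

text \<open>Integrating the weight e^(K|s|) gains a factor 1/K; this gain is what makes the Picard
  operator a contraction in the weighted norm.\<close>

lemma signed_integral_exp_bound:
  fixes f :: "real \<Rightarrow> 'a::euclidean_space"
  assumes "continuous_on UNIV f" and "K > 0" and "C \<ge> 0"
    and bnd: "\<And>s. norm (f s) \<le> C * exp (K * \<bar>s\<bar>)"
  shows "norm (integral {0..t} f - integral {t..0} f) \<le> C / K * exp (K * \<bar>t\<bar>)"
proof -
  have int: "f integrable_on {a..b}" for a b
    by (rule integrable_continuous_interval) (rule continuous_on_subset[OF assms(1)], simp)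
  show ?thesis
  proof (cases "t \<ge> 0")
    case True
    have "((\<lambda>s. C * exp (K * s)) has_integral C / K * exp (K * t) - C / K * exp (K * 0)) {0..t}"
      by (rule fundamental_theorem_of_calculus)
         (use True assms in \<open>auto intro!: derivative_eq_intros
            simp flip: has_real_derivative_iff_has_vector_derivative\<close>)
    moreover have bnd': "norm (f s) \<le> C * exp (K * s)" if "s \<in> {0..t}" for s
      using bnd[of s] that by simp
    ultimately have "norm (integral {0..t} f) \<le> C / K * exp (K * t) - C / K * exp (K * 0)"
      using integral_norm_bound_integral[OF int, of "\<lambda>s. C * exp (K * s)" 0 t] bnd'
      by (force simp: has_integral_iff)
    moreover have "integral {t..0} f = 0"
      using True by (cases "t = 0") auto
    ultimately show ?thesis using True assms
      by (smt (verit) diff_zero divide_nonneg_pos mult_nonneg_nonneg exp_ge_zero)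
  next
    case False
    have "((\<lambda>s. C * exp (- K * s)) has_integral - C / K * exp (- K * 0) - (- C / K * exp (- K * t))) {t..0}"
      by (rule fundamental_theorem_of_calculus)
         (use False assms in \<open>auto intro!: derivative_eq_intros
            simp flip: has_real_derivative_iff_has_vector_derivative\<close>)
    moreover have "norm (f s) \<le> C * exp (- K * s)" if "s \<in> {t..0}" for s
      using bnd[of s] that by simp
    ultimately have "norm (integral {t..0} f) \<le> - C / K * exp (- K * 0) - (- C / K * exp (- K * t))"
      using integral_norm_bound_integral[OF int, of "\<lambda>s. C * exp (- K * s)" t 0]
      by (force simp: has_integral_iff)
    moreover have "C / K \<ge> 0" using assms by simp
    ultimately show ?thesis using False by simp
  qed
qed

text \<open>Picard iteration in the weighted norm $\sup_t e^{-2K|t|}|x(t) - x_0|$, for which the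
  integral operator is a contraction on the whole line at once.\<close>

lemma lipschitz_ode_solution:
  fixes F :: "'a::euclidean_space \<Rightarrow> 'a"
  assumes lip: "\<And>x y. norm (F x - F y) \<le> L * norm (x - y)"
  obtains x where "x 0 = x0" and "\<And>t. (x has_vector_derivative F (x t)) (at t)"
proof -
  define K where "K = \<bar>L\<bar> + 1"
  have K: "K > 0" and lipK: "norm (F x - F y) \<le> K * norm (x - y)" for x y
    using order_trans[OF lip[of x y] mult_right_mono[of L K "norm (x - y)"]] by (auto simp: K_def)
  have contF: "continuous_on UNIV F"
    by (rule lipschitz_on_continuous_on[of K], rule lipschitz_onI) (use K lipK in \<open>auto simp: dist_norm\<close>)
  have cancel: "exp (- 2 * K * s) * (q * exp (2 * K * s)) = q" for s q
    by (simp add: exp_minus)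
  \<comment> \<open>The unknown \<phi> stands for e^(-2K|s|) (x(s) - x0). Unlike x itself it is
    bounded, so it lives in the complete space of bounded continuous functions.\<close>
  define f where "f = (\<lambda>\<phi> s. F (x0 + exp (2 * K * \<bar>s\<bar>) *\<^sub>R apply_bcontfun \<phi> s))"
  define G where "G = (\<lambda>\<phi> t. integral {0..t} (f \<phi>) - integral {t..0} (f \<phi>))"
  have contf: "continuous_on UNIV (f \<phi>)" for \<phi>
    unfolding f_def
    by (intro continuous_on_compose2[OF contF] continuous_intros) auto
  have fbnd: "norm (f \<phi> s) \<le> (norm (F x0) + K * norm \<phi>) * exp (2 * K * \<bar>s\<bar>)" for \<phi> s
  proof -
    have "norm (f \<phi> s) \<le> norm (F x0) + norm (f \<phi> s - F x0)"
      by norm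
    also have "norm (f \<phi> s - F x0) \<le> K * norm (exp (2 * K * \<bar>s\<bar>) *\<^sub>R apply_bcontfun \<phi> s)"
      unfolding f_def by (rule order_trans[OF lipK]) simp
    also have "\<dots> \<le> K * (exp (2 * K * \<bar>s\<bar>) * norm \<phi>)"
      using K norm_bounded[of \<phi> s] by (auto intro!: mult_left_mono)
    also have "norm (F x0) \<le> norm (F x0) * exp (2 * K * \<bar>s\<bar>)"
      using K by (simp add: mult_le_cancel_left1)
    finally show ?thesis by (simp add: algebra_simps)
  qed
  have der: "(G \<phi> has_vector_derivative f \<phi> t) (at t)" for \<phi> t
    unfolding G_def by (rule signed_integral_has_vector_derivative[OF contf])
  have contG: "continuous_on UNIV (G \<phi>)" for \<phi>
    by (rule continuous_on_vector_derivative[OF has_vector_derivative_at_within[OF der]])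
  define P where "P = (\<lambda>\<phi> t. exp (- 2 * K * \<bar>t\<bar>) *\<^sub>R G \<phi> t)"
  have P: "P \<phi> \<in> bcontfun" for \<phi>
  proof (rule bcontfun_normI)
    show "continuous_on UNIV (P \<phi>)"
      unfolding P_def by (intro continuous_intros contG)
    fix t
    have "norm (G \<phi> t) \<le> (norm (F x0) + K * norm \<phi>) / (2 * K) * exp (2 * K * \<bar>t\<bar>)"
      unfolding G_def using K fbnd by (intro signed_integral_exp_bound contf) auto
    then have "exp (- 2 * K * \<bar>t\<bar>) * norm (G \<phi> t) \<le> exp (- 2 * K * \<bar>t\<bar>) *
        ((norm (F x0) + K * norm \<phi>) / (2 * K) * exp (2 * K * \<bar>t\<bar>))"
      by (rule mult_left_mono) simp
    moreover have "norm (P \<phi> t) = exp (- 2 * K * \<bar>t\<bar>) * norm (G \<phi> t)"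
      by (simp add: P_def)
    ultimately show "norm (P \<phi> t) \<le> (norm (F x0) + K * norm \<phi>) / (2 * K)"
      by (simp only: cancel)
  qed
  define \<Phi> where "\<Phi> = (\<lambda>\<phi>. Bcontfun (P \<phi>))"
  have \<Phi>: "apply_bcontfun (\<Phi> \<phi>) = P \<phi>" for \<phi>
    unfolding \<Phi>_def by (rule Bcontfun_inverse[OF P])
  \<comment> \<open>The Lipschitz constant K meets the gain 1/(2K) of integrating the weight
    e^(2K|s|), which leaves the factor 1/2.\<close>
  have contr: "dist (\<Phi> \<phi>) (\<Phi> \<psi>) \<le> 1/2 * dist \<phi> \<psi>" for \<phi> \<psi>
  proof (rule dist_bound)
    fix t
    have int: "f \<phi> integrable_on {a..b}" for a b \<phi>
      by (rule integrable_continuous_interval) (rule continuous_on_subset[OF contf], simp)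
    have "G \<phi> t - G \<psi> t = integral {0..t} (\<lambda>s. f \<phi> s - f \<psi> s) - integral {t..0} (\<lambda>s. f \<phi> s - f \<psi> s)"
      unfolding G_def by (simp add: Henstock_Kurzweil_Integration.integral_diff int)
    also have "norm \<dots> \<le> K * dist \<phi> \<psi> / (2 * K) * exp (2 * K * \<bar>t\<bar>)"
    proof (rule signed_integral_exp_bound)
      show "norm (f \<phi> s - f \<psi> s) \<le> K * dist \<phi> \<psi> * exp (2 * K * \<bar>s\<bar>)" for s
      proof -
        have "norm (f \<phi> s - f \<psi> s) \<le>
            K * norm (exp (2 * K * \<bar>s\<bar>) *\<^sub>R apply_bcontfun \<phi> s - exp (2 * K * \<bar>s\<bar>) *\<^sub>R apply_bcontfun \<psi> s)"
          unfolding f_def by (rule order_trans[OF lipK]) simp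
        also have "\<dots> = K * (exp (2 * K * \<bar>s\<bar>) * dist (apply_bcontfun \<phi> s) (apply_bcontfun \<psi> s))"
          by (simp add: dist_norm flip: scaleR_diff_right)
        also have "\<dots> \<le> K * (exp (2 * K * \<bar>s\<bar>) * dist \<phi> \<psi>)"
          using K dist_bounded[of \<phi> s \<psi>] by (intro mult_left_mono) auto
        finally show ?thesis by (simp add: mult_ac)
      qed
    qed (use K in \<open>auto intro!: continuous_intros contf\<close>)
    finally have "norm (G \<phi> t - G \<psi> t) \<le> 1/2 * dist \<phi> \<psi> * exp (2 * K * \<bar>t\<bar>)"
      using K by simp
    then have "exp (- 2 * K * \<bar>t\<bar>) * norm (G \<phi> t - G \<psi> t) \<le>
        exp (- 2 * K * \<bar>t\<bar>) * (1/2 * dist \<phi> \<psi> * exp (2 * K * \<bar>t\<bar>))"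
      by (rule mult_left_mono) simp
    also have "\<dots> = 1/2 * dist \<phi> \<psi>" by (rule cancel)
    finally show "dist (apply_bcontfun (\<Phi> \<phi>) t) (apply_bcontfun (\<Phi> \<psi>) t) \<le> 1/2 * dist \<phi> \<psi>"
      unfolding \<Phi> P_def dist_norm by (simp flip: scaleR_diff_right)
  qed
  then obtain \<phi> where fixpt: "\<Phi> \<phi> = \<phi>"
    using banach_fix_type[of "1/2" \<Phi>] by auto
  define x where "x = (\<lambda>t. x0 + G \<phi> t)"
  have "apply_bcontfun \<phi> t = exp (- 2 * K * \<bar>t\<bar>) *\<^sub>R G \<phi> t" for t
    using \<Phi>[of \<phi>] by (simp add: fixpt P_def)
  then have fx: "f \<phi> t = F (x t)" for t
    by (simp add: f_def x_def flip: exp_add)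
  have "(x has_vector_derivative F (x t)) (at t)" for t
    using der[of \<phi> t] unfolding fx unfolding x_def
    by (auto intro!: derivative_eq_intros)
  moreover have "x 0 = x0" by (simp add: x_def G_def)
  ultimately show ?thesis using that by blast
qed

text \<open>Gronwall's inequality in differential form: the squared distance of the two solutions,
  damped by e^(-2L(s - a)), has nonpositive derivative by Cauchy-Schwarz.\<close>

lemma lipschitz_ode_forward:
  fixes x y :: "real \<Rightarrow> 'a::real_inner"
  assumes lip: "\<And>x y. norm (F x - F y) \<le> L * norm (x - y)"
    and "a \<le> b"
    and x: "\<And>s. s \<in> {a..b} \<Longrightarrow> (x has_vector_derivative F (x s)) (at s)"
    and y: "\<And>s. s \<in> {a..b} \<Longrightarrow> (y has_vector_derivative F (y s)) (at s)"
  shows "norm (x b - y b) \<le> norm (x a - y a) * exp (L * (b - a))"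
proof -
  define d where "d = (\<lambda>s. x s - y s)"
  define \<phi> where "\<phi> = (\<lambda>s. (d s \<bullet> d s) * exp (- 2 * L * (s - a)))"
  have "\<phi> b \<le> \<phi> a"
  proof (rule DERIV_nonpos_imp_nonincreasing[OF \<open>a \<le> b\<close>])
    fix s assume s: "a \<le> s" "s \<le> b"
    have d': "(d has_vector_derivative F (x s) - F (y s)) (at s)"
      unfolding d_def using x y s by (auto intro!: derivative_eq_intros)
    let ?D = "2 * (d s \<bullet> (F (x s) - F (y s)))"
    have "((\<lambda>s. d s \<bullet> d s) has_real_derivative ?D) (at s)"
      using bounded_bilinear.has_vector_derivative[OF bounded_bilinear_inner d' d']
      by (simp add: has_real_derivative_iff_has_vector_derivative inner_commute)
    then have "(\<phi> has_real_derivative (?D - 2 * L * (d s \<bullet> d s)) * exp (- 2 * L * (s - a))) (at s)"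
      unfolding \<phi>_def by (auto intro!: derivative_eq_intros simp: algebra_simps)
    moreover have "d s \<bullet> (F (x s) - F (y s)) \<le> L * (d s \<bullet> d s)"
    proof -
      have "d s \<bullet> (F (x s) - F (y s)) \<le> norm (d s) * norm (F (x s) - F (y s))"
        by (rule norm_cauchy_schwarz)
      also have "\<dots> \<le> norm (d s) * (L * norm (d s))"
        unfolding d_def by (intro mult_left_mono lip) auto
      finally show ?thesis by (simp add: dot_square_norm power2_eq_square mult_ac)
    qed
    ultimately show "\<exists>y. (\<phi> has_real_derivative y) (at s) \<and> y \<le> 0"
      by (intro exI[of _ "(?D - 2 * L * (d s \<bullet> d s)) * exp (- 2 * L * (s - a))"] conjI)
         (auto simp: mult_le_0_iff)
  qed
  then have "(norm (d b))\<^sup>2 * exp (- 2 * L * (b - a)) \<le> (norm (d a))\<^sup>2"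
    by (simp add: \<phi>_def dot_square_norm)
  then have "(norm (d b))\<^sup>2 * exp (- 2 * L * (b - a)) * exp (2 * L * (b - a))
      \<le> (norm (d a))\<^sup>2 * exp (2 * L * (b - a))"
    by (rule mult_right_mono) simp
  then have "(norm (d b))\<^sup>2 \<le> (norm (d a))\<^sup>2 * exp (2 * L * (b - a))"
    by (simp add: mult.assoc flip: exp_add)
  also have "\<dots> = (norm (d a) * exp (L * (b - a)))\<^sup>2"
    by (simp add: power_mult_distrib flip: exp_double)
  finally show ?thesis
    unfolding d_def by (rule power2_le_imp_le) simp
qed

lemma lipschitz_ode_unique:
  fixes x y :: "real \<Rightarrow> 'a::real_inner"
  assumes lip: "\<And>x y. norm (F x - F y) \<le> L * norm (x - y)"
    and x: "\<And>s. s \<in> closed_segment a b \<Longrightarrow> (x has_vector_derivative F (x s)) (at s)"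
    and y: "\<And>s. s \<in> closed_segment a b \<Longrightarrow> (y has_vector_derivative F (y s)) (at s)"
    and "x a = y a"
  shows "x b = y b"
proof (cases "a \<le> b")
  case True
  then show ?thesis
    using lipschitz_ode_forward[OF lip, of a b x y] assms
    by (auto simp: closed_segment_eq_real_ivl)
next
  case False
  \<comment> \<open>Backward uniqueness is forward uniqueness for the reversed curves, which solve
    the equation with field -F.\<close>
  have rev: "((\<lambda>s. w (- s)) has_vector_derivative - F (w (- s))) (at s)"
    if "(w has_vector_derivative F (w (- s))) (at (- s))" for w s
    using vector_diff_chain_at[of uminus "-1" s w] that
    by (simp add: o_def has_vector_derivative_minus[OF has_vector_derivative_id, simplified])
  have "norm (x (- (- b)) - y (- (- b))) \<le> norm (x (- (- a)) - y (- (- a))) * exp (L * (- b - (- a)))"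
  proof (rule lipschitz_ode_forward[where F = "\<lambda>x. - F x"])
    show "norm (- F x - - F y) \<le> L * norm (x - y)" for x y
      using lip[of x y] by (simp add: norm_minus_commute)
  qed (use False x y in \<open>auto intro!: rev simp: closed_segment_eq_real_ivl\<close>)
  with \<open>x a = y a\<close> show ?thesis by simp
qed

section \<open>Bounded Lipschitz maps and bilinear operations\<close>

definition bounded_lipschitz :: "('a::real_normed_vector \<Rightarrow> 'b::real_normed_vector) \<Rightarrow> bool" where
  "bounded_lipschitz f \<longleftrightarrow>
     (\<exists>C. \<forall>x. norm (f x) \<le> C \<and> (\<forall>y. norm (f x - f y) \<le> C * norm (x - y)))"

lemma bounded_lipschitzI:
  assumes "\<And>x. norm (f x) \<le> C" and "\<And>x y. norm (f x - f y) \<le> L * norm (x - y)"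
  shows "bounded_lipschitz f"
  unfolding bounded_lipschitz_def
proof (intro exI[of _ "max C L"] allI conjI)
  show "norm (f x) \<le> max C L" for x using assms(1)[of x] by simp
  show "norm (f x - f y) \<le> max C L * norm (x - y)" for x y
    by (rule order_trans[OF assms(2)]) (auto intro: mult_right_mono)
qed

lemma bounded_lipschitzE:
  assumes "bounded_lipschitz f"
  obtains C where "C \<ge> 0" "\<And>x. norm (f x) \<le> C" "\<And>x y. norm (f x - f y) \<le> C * norm (x - y)"
  using assms unfolding bounded_lipschitz_def by (meson norm_ge_zero order_trans)

lemma bounded_lipschitz_compose:
  assumes "bounded_lipschitz f" and "\<And>x y. norm (p x - p y) \<le> norm (x - y)"
  shows "bounded_lipschitz (\<lambda>x. f (p x))"
proof -
  obtain C where C: "C \<ge> 0" "\<And>x. norm (f x) \<le> C" "\<And>x y. norm (f x - f y) \<le> C * norm (x - y)"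
    using assms(1) by (rule bounded_lipschitzE) blast
  show ?thesis
    by (rule bounded_lipschitzI[where C = C and L = C])
       (auto intro: C(2) order_trans[OF C(3)] mult_left_mono[OF assms(2) C(1)])
qed

text \<open>Boundedness is carried along with the Lipschitz property precisely for this closure: in
  the splitting of the difference of two products, each increment is multiplied by a value of the
  other factor.\<close>

lemma (in bounded_bilinear) bounded_lipschitz_prod:
  assumes "bounded_lipschitz f" and "bounded_lipschitz g"
  shows "bounded_lipschitz (\<lambda>x. prod (f x) (g x))"
proof -
  obtain C where C: "C \<ge> 0" "\<And>x. norm (f x) \<le> C" "\<And>x y. norm (f x - f y) \<le> C * norm (x - y)"
    using assms(1) by (rule bounded_lipschitzE) blast
  obtain D where D: "D \<ge> 0" "\<And>x. norm (g x) \<le> D" "\<And>x y. norm (g x - g y) \<le> D * norm (x - y)"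
    using assms(2) by (rule bounded_lipschitzE) blast
  obtain K where K: "K \<ge> 0" "\<And>a b. norm (prod a b) \<le> norm a * norm b * K"
    using nonneg_bounded by auto
  show ?thesis
  proof (rule bounded_lipschitzI)
    fix x y
    show "norm (prod (f x) (g x)) \<le> C * D * K"
      by (rule order_trans[OF K(2)]) (intro mult_mono C D K; simp add: C D)
    have "prod (f x) (g x) - prod (f y) (g y) = prod (f x - f y) (g x) + prod (f y) (g x - g y)"
      by (simp add: diff_left diff_right)
    also have "norm \<dots> \<le> norm (f x - f y) * norm (g x) * K + norm (f y) * norm (g x - g y) * K"
      by (rule norm_triangle_le) (intro add_mono K(2))
    also have "\<dots> \<le> (C * norm (x - y)) * D * K + C * (D * norm (x - y)) * K"
      by (intro add_mono mult_mono C D K order_refl mult_nonneg_nonneg norm_ge_zero)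
    finally show "norm (prod (f x) (g x) - prod (f y) (g y)) \<le> (2 * C * D * K) * norm (x - y)"
      by (simp add: algebra_simps)
  qed
qed

lemma bounded_lipschitz_vec:
  fixes f :: "'i::finite \<Rightarrow> 'a::real_normed_vector \<Rightarrow> real"
  assumes "\<And>k. bounded_lipschitz (f k)"
  shows "bounded_lipschitz (\<lambda>x. \<chi> k. f k x)"
proof -
  have "\<exists>C. \<forall>k. (\<forall>x. norm (f k x) \<le> C k) \<and> (\<forall>x y. norm (f k x - f k y) \<le> C k * norm (x - y))"
    using assms unfolding bounded_lipschitz_def by metis
  then obtain C where C: "\<And>k x. norm (f k x) \<le> C k"
    "\<And>k x y. norm (f k x - f k y) \<le> C k * norm (x - y)" by blast
  show ?thesis
  proof (rule bounded_lipschitzI)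
    fix x y
    have "norm (\<chi> k. f k x) \<le> (\<Sum>k\<in>UNIV. norm (f k x))"
      using norm_le_l1_cart[of "\<chi> k. f k x"] by simp
    also have "\<dots> \<le> (\<Sum>k\<in>UNIV. C k)" by (intro sum_mono C)
    finally show "norm (\<chi> k. f k x) \<le> (\<Sum>k\<in>UNIV. C k)" .
    have "norm ((\<chi> k. f k x) - (\<chi> k. f k y)) \<le> (\<Sum>k\<in>UNIV. norm (f k x - f k y))"
      using norm_le_l1_cart[of "(\<chi> k. f k x) - (\<chi> k. f k y)"] by simp
    also have "\<dots> \<le> (\<Sum>k\<in>UNIV. C k * norm (x - y))" by (intro sum_mono C)
    finally show "norm ((\<chi> k. f k x) - (\<chi> k. f k y)) \<le> (\<Sum>k\<in>UNIV. C k) * norm (x - y)"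
      by (simp add: sum_distrib_right)
  qed
qed

text \<open>The derivative is bounded on \<open>K\<close> by compactness and vanishes elsewhere, so
  the mean value inequality applies on the whole space. Continuity is asked only in basis
  directions, which matches the directional form of \<open>times_differentiable\<close>; the
  operator norm is then bounded by the sum over the basis.\<close>

lemma compactly_supported_derivative_lipschitz:
  fixes f :: "'a::euclidean_space \<Rightarrow> 'b::real_normed_vector"
  assumes der: "\<And>x. (f has_derivative D x) (at x)"
    and cont: "\<And>b. b \<in> Basis \<Longrightarrow> continuous_on UNIV (\<lambda>x. D x b)"
    and "compact K" and zero: "\<And>x b. x \<notin> K \<Longrightarrow> D x b = 0"
  shows "\<exists>L. \<forall>x y. norm (f x - f y) \<le> L * norm (x - y)"
proof -
  have "\<exists>C. \<forall>x\<in>K. norm (D x b) \<le> C" if "b \<in> Basis" for b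
    using compact_imp_bounded[OF compact_continuous_image[OF continuous_on_subset[OF cont[OF that]] \<open>compact K\<close>]]
    by (auto simp: bounded_iff)
  then obtain C where C: "\<And>b x. b \<in> Basis \<Longrightarrow> x \<in> K \<Longrightarrow> norm (D x b) \<le> C b" by metis
  have C': "norm (D x b) \<le> \<bar>C b\<bar>" if "b \<in> Basis" for x b
    using C[OF that, of x] zero[of x b] by (cases "x \<in> K") auto
  have on: "onorm (D x) \<le> (\<Sum>b\<in>Basis. \<bar>C b\<bar>)" for x
  proof (rule onorm_le)
    fix v
    interpret bounded_linear "D x" using der by (rule has_derivative_bounded_linear)
    have "D x v = D x (\<Sum>b\<in>Basis. (v \<bullet> b) *\<^sub>R b)" by (simp add: euclidean_representation)
    also have "\<dots> = (\<Sum>b\<in>Basis. (v \<bullet> b) *\<^sub>R D x b)" by (simp add: sum scaleR)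
    also have "norm \<dots> \<le> (\<Sum>b\<in>Basis. norm v * \<bar>C b\<bar>)"
      by (rule sum_norm_le) (auto intro!: mult_mono C' Basis_le_norm)
    finally show "norm (D x v) \<le> (\<Sum>b\<in>Basis. \<bar>C b\<bar>) * norm v"
      by (simp add: sum_distrib_right sum_distrib_left mult.commute)
  qed
  show ?thesis
    using differentiable_bound[of UNIV f D, OF _ _ on] der by auto
qed

lemma bounded_bilinear_matrix_vector_mult:
  "bounded_bilinear ((*v) :: real ^ 'n::finite ^ 'm::finite \<Rightarrow> _)"
  unfolding bilinear_conv_bounded_bilinear[symmetric] bilinear_def
  by (auto intro!: linearI simp: algebra_simps matrix_scaleR_vector_ac scaleR_matrix_vector_assoc)

lemma bounded_bilinear_matrix_matrix_mult:
  "bounded_bilinear ((**) :: real ^ 'n::finite ^ 'm::finite \<Rightarrow> real ^ 'k::finite ^ 'n \<Rightarrow> _)"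
  unfolding bilinear_conv_bounded_bilinear[symmetric] bilinear_def
  by (auto intro!: linearI simp: matrix_matrix_mult_def vec_eq_iff algebra_simps sum.distrib sum_distrib_left)

text \<open>Disposes of the second-order remainder when the matrix inverse is
  differentiated.\<close>

lemma has_derivative_quadratic_error:
  fixes f :: "'a::real_normed_vector \<Rightarrow> 'b::real_normed_vector"
  assumes "\<And>y. norm (f y) \<le> C * (norm (y - x))\<^sup>2" and "f x = 0"
  shows "(f has_derivative (\<lambda>_. 0)) (at x)"
  unfolding has_derivative_iff_norm
proof (intro conjI)
  have "((\<lambda>y. C * norm (y - x)) \<longlongrightarrow> C * norm (x - x)) (at x)" by (intro tendsto_intros)
  then have lim: "((\<lambda>y. C * norm (y - x)) \<longlongrightarrow> 0) (at x)" by simp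
  show "((\<lambda>y. norm (f y - f x - 0) / norm (y - x)) \<longlongrightarrow> 0) (at x)"
  proof (rule tendsto_sandwich[OF _ _ tendsto_const lim])
    show "\<forall>\<^sub>F y in at x. norm (f y - f x - 0) / norm (y - x) \<le> C * norm (y - x)"
      using assms by (auto simp: eventually_at_filter divide_le_eq power2_eq_square mult.assoc)
  qed simp
qed simp

lemma GDERIV_unique: "GDERIV f x :> a \<Longrightarrow> GDERIV f x :> b \<Longrightarrow> a = b"
  unfolding gderiv_def by (drule (1) has_derivative_unique) (metis inner_commute vector_eq_ldot)

type_synonym 'n state = "real \<times> real \<times> (real ^ 'n) \<times> (real ^ 'n)"

section \<open>Metrics that are flat outside a compact set\<close>

locale flat_family =
  fixes g :: "real \<Rightarrow> real ^ 'n \<Rightarrow> real ^ 'n ^ 'n" and R T :: real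
  assumes smooth_g: "smooth_metric_family g" and flat_g: "flat_outside g R T" and R_pos: "R > 0"
begin

definition G :: "real \<times> (real ^ 'n) \<Rightarrow> real ^ 'n ^ 'n" where
  "G x = g (fst x) (snd x)"

definition A :: "real \<times> (real ^ 'n) \<Rightarrow> real ^ 'n ^ 'n" where
  "A x = matrix_inv (G x)"

definition DG :: "real \<times> (real ^ 'n) \<Rightarrow> real \<times> (real ^ 'n) \<Rightarrow> real ^ 'n ^ 'n" where
  "DG x = frechet_derivative G (at x)"

definition B :: "'n \<Rightarrow> real \<times> (real ^ 'n) \<Rightarrow> real ^ 'n ^ 'n" where
  "B k x = DG x (0, axis k 1)"

text \<open>The right-hand side of the geodesic equation for the covector \<theta> = G w: its k-th
  component is half of \<partial>_k G evaluated on the velocity w. In terms of the inverse metric it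
  is minus the z-gradient of half the energy \<theta> \<bullet> A \<theta>.\<close>

definition force :: "real \<times> (real ^ 'n) \<Rightarrow> real ^ 'n \<Rightarrow> real ^ 'n" where
  "force x w = (\<chi> k. (w \<bullet> (B k x *v w)) / 2)"

lemma times_differentiable_G: "times_differentiable k G"
  using smooth_g unfolding smooth_metric_family_def smooth_def G_def[abs_def]
  by (simp add: case_prod_beta')

lemma G_deriv: "(G has_derivative DG x) (at x)"
  using times_differentiable_G[of 1]
  by (simp add: DG_def frechet_derivative_works del: split_paired_All)

lemma DG_deriv: "((\<lambda>x. DG x v) has_derivative frechet_derivative (\<lambda>x. DG x v) (at x)) (at x)"
  using times_differentiable_G[of 2]
  by (simp add: DG_def frechet_derivative_works numeral_2_eq_2 del: split_paired_All)

lemma DG_deriv_cont: "continuous_on UNIV (\<lambda>x. frechet_derivative (\<lambda>x. DG x v) (at x) w)"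
  using times_differentiable_G[of 2] by (simp add: DG_def numeral_2_eq_2 del: split_paired_All)

lemma DG_cont: "continuous_on UNIV (\<lambda>x. DG x v)"
  by (rule continuous_at_imp_continuous_on) (use has_derivative_continuous[OF DG_deriv] in blast)

lemma linear_DG: "linear (DG x)"
  using G_deriv by (rule has_derivative_linear)

lemma G_flat: "norm (snd x) \<ge> R \<or> \<bar>fst x\<bar> \<ge> T \<Longrightarrow> G x = mat 1"
  using flat_g unfolding flat_outside_def G_def by auto

lemma G_sym: "transpose (G x) = G x"
  using smooth_g unfolding smooth_metric_family_def riemannian_def G_def by auto

lemma G_pos: "v \<noteq> 0 \<Longrightarrow> v \<bullet> (G x *v v) > 0"
  using smooth_g unfolding smooth_metric_family_def riemannian_def G_def by auto

text \<open>\<open>matrix_inv\<close> is a choice among inverses and says nothing before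
  invertibility is known; positive definiteness gives injectivity, hence invertibility.\<close>

lemma G_A: "G x ** A x = mat 1" and A_G: "A x ** G x = mat 1"
proof -
  have "inj ((*v) (G x))"
  proof (rule injI)
    fix v w assume "G x *v v = G x *v w"
    then have "G x *v (v - w) = 0" by (simp add: algebra_simps)
    then show "v = w" using G_pos[of "v - w" x] by auto
  qed
  then have "invertible (G x)"
    using matrix_left_invertible_injective invertible_left_inverse by blast
  then have "\<exists>A'. G x ** A' = mat 1 \<and> A' ** G x = mat 1" by (simp add: invertible_def)
  then have "G x ** A x = mat 1 \<and> A x ** G x = mat 1"
    unfolding A_def matrix_inv_def by (rule someI_ex)
  then show "G x ** A x = mat 1" "A x ** G x = mat 1" by auto
qed

lemma G_A_vec [simp]: "G x *v (A x *v v) = v" and A_G_vec [simp]: "A x *v (G x *v v) = v"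
  by (simp_all add: matrix_vector_mul_assoc G_A A_G)

lemma A_flat: "norm (snd x) \<ge> R \<or> \<bar>fst x\<bar> \<ge> T \<Longrightarrow> A x = mat 1"
  using G_A[of x] by (simp add: G_flat)

lemma inner_G: "v \<bullet> (G x *v w) = (G x *v v) \<bullet> w"
  by (metis G_sym dot_lmul_matrix vector_transpose_matrix)

lemma inner_A: "v \<bullet> (A x *v w) = (A x *v v) \<bullet> w"
  by (metis G_A_vec inner_G)

lemma DG_sym: "transpose (DG x v) = DG x v"
proof -
  have lin: "bounded_linear (transpose :: real ^ 'n ^ 'n \<Rightarrow> _)"
    by (intro linear_conv_bounded_linear[THEN iffD1] linearI) (simp_all add: transpose_def vec_eq_iff)
  have "((\<lambda>x. transpose (G x)) has_derivative (\<lambda>v. transpose (DG x v))) (at x)"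
    by (rule bounded_linear.has_derivative[OF lin G_deriv])
  then have "(G has_derivative (\<lambda>v. transpose (DG x v))) (at x)" by (simp add: G_sym)
  from has_derivative_unique[OF this G_deriv] show ?thesis by metis
qed

text \<open>Constancy of \<open>G\<close> gives this on the open set |z| > R only. The sphere |z| =
  R is reached by continuity, moving radially inward from outside. Including the sphere allows
  straight motion to start exactly where a geodesic meets it.\<close>

lemma DG_zero:
  assumes "norm (snd x) \<ge> R"
  shows "DG x v = 0"
proof -
  let ?S = "{x :: real \<times> (real ^ 'n). norm (snd x) > R}"
  have "open ?S" by (intro open_Collect_less continuous_intros)
  have zero: "DG y v = 0" if "norm (snd y) > R" for y
  proof -
    have "((\<lambda>_. mat 1) has_derivative (\<lambda>_. 0)) (at y)" by simp
    then have "(G has_derivative (\<lambda>_. 0)) (at y)"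
      by (rule has_derivative_transform_within_open[OF _ \<open>open ?S\<close>]) (use that G_flat in auto)
    from has_derivative_unique[OF this G_deriv] show ?thesis by metis
  qed
  have "(\<lambda>n. DG (fst x, (1 + 1 / real (Suc n)) *\<^sub>R snd x) v) \<longlonglongrightarrow> DG (fst x, (1 + 0) *\<^sub>R snd x) v"
  proof (rule continuous_on_tendsto_compose[OF DG_cont])
    show "(\<lambda>n. (fst x, (1 + 1 / real (Suc n)) *\<^sub>R snd x)) \<longlonglongrightarrow> (fst x, (1 + 0) *\<^sub>R snd x)"
      using LIMSEQ_Suc[OF lim_1_over_n] by (intro tendsto_intros) simp
  qed auto
  moreover have "DG (fst x, (1 + 1 / real (Suc n)) *\<^sub>R snd x) v = 0" for n
  proof (rule zero)
    have "norm (snd x) > 0" using assms R_pos by linarith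
    then have "1 * norm (snd x) < (1 + 1 / real (Suc n)) * norm (snd x)"
      by (intro mult_strict_right_mono) auto
    then show "norm (snd (fst x, (1 + 1 / real (Suc n)) *\<^sub>R snd x)) > R"
      using assms by simp
  qed
  ultimately show ?thesis by (simp add: LIMSEQ_const_iff)
qed

text \<open>The absolute value covers negative T. The complement is open and \<open>G\<close> is
  constant on it, so derivatives of all needed orders vanish there.\<close>

definition K :: "(real \<times> (real ^ 'n)) set" where
  "K = cball 0 (\<bar>T\<bar>) \<times> cball 0 R"

lemma compact_K: "compact K"
  unfolding K_def by (intro compact_Times compact_cball)

lemma G_outside_K: "x \<notin> K \<Longrightarrow> G x = mat 1"
  by (rule G_flat) (cases x, auto simp: K_def)

lemma DG_outside_K: "x \<notin> K \<Longrightarrow> DG x v = 0"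
proof -
  assume x: "x \<notin> K"
  have "((\<lambda>_. mat 1) has_derivative (\<lambda>_. 0)) (at x)" by simp
  then have "(G has_derivative (\<lambda>_. 0)) (at x)"
    by (rule has_derivative_transform_within_open[where s = "- K"])
       (use x G_outside_K compact_K in \<open>auto simp: compact_imp_closed\<close>)
  from has_derivative_unique[OF this G_deriv] show ?thesis by metis
qed

lemma DDG_outside_K: "x \<notin> K \<Longrightarrow> frechet_derivative (\<lambda>x. DG x v) (at x) w = 0"
proof -
  assume x: "x \<notin> K"
  have "((\<lambda>_. 0) has_derivative (\<lambda>_. 0)) (at x)" by simp
  then have "((\<lambda>x. DG x v) has_derivative (\<lambda>_. 0)) (at x)"
    by (rule has_derivative_transform_within_open[where s = "- K"])
       (use x DG_outside_K compact_K in \<open>auto simp: compact_imp_closed\<close>)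
  from has_derivative_unique[OF this DG_deriv] show ?thesis by metis
qed

lemma bounded_lipschitz_supported:
  fixes f :: "real \<times> (real ^ 'n) \<Rightarrow> real ^ 'n ^ 'n"
  assumes der: "\<And>x. (f has_derivative D x) (at x)"
    and "\<And>b. continuous_on UNIV (\<lambda>x. D x b)"
    and "\<And>x b. x \<notin> K \<Longrightarrow> D x b = 0" and const: "\<And>x. x \<notin> K \<Longrightarrow> f x = c"
  shows "bounded_lipschitz f"
proof -
  obtain L where L: "\<And>x y. norm (f x - f y) \<le> L * norm (x - y)"
    using compactly_supported_derivative_lipschitz[OF der _ compact_K] assms by metis
  have "continuous_on K f"
    by (meson der continuous_at_imp_continuous_on has_derivative_continuous)
  from compact_imp_bounded[OF compact_continuous_image[OF this compact_K]]
  obtain C where "\<And>x. x \<in> K \<Longrightarrow> norm (f x) \<le> C" by (auto simp: bounded_iff)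
  then have "norm (f x) \<le> max C (norm c)" for x
    using const[of x] by (cases "x \<in> K") (simp_all add: le_max_iff_disj)
  then show ?thesis using L by (rule bounded_lipschitzI)
qed

lemma bounded_lipschitz_G: "bounded_lipschitz G"
  by (rule bounded_lipschitz_supported[OF G_deriv DG_cont DG_outside_K G_outside_K])

lemma bounded_lipschitz_B: "bounded_lipschitz (B k)"
  unfolding B_def[abs_def]
  by (rule bounded_lipschitz_supported[OF DG_deriv DG_deriv_cont DDG_outside_K DG_outside_K])

section \<open>Uniform ellipticity and the inverse metric\<close>

lemma G_elliptic: "\<exists>c>0. \<forall>x v. c * (norm v)\<^sup>2 \<le> v \<bullet> (G x *v v)"
proof -
  let ?S = "K \<times> sphere (0 :: real ^ 'n) 1"
  define q where "q = (\<lambda>(x, v). v \<bullet> (G x *v v))"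
  have "continuous_on UNIV G"
    by (meson G_deriv continuous_at_imp_continuous_on has_derivative_continuous)
  then have "continuous_on ?S (\<lambda>p. G (fst p))"
    by (rule continuous_on_compose2[OF _ continuous_on_fst[OF continuous_on_id]]) simp
  from bounded_bilinear.continuous_on[OF bounded_bilinear_matrix_vector_mult this
    continuous_on_snd[OF continuous_on_id]]
  have "continuous_on ?S q"
    unfolding q_def case_prod_beta by (intro continuous_on_inner continuous_on_snd continuous_on_id)
  moreover have "compact ?S" using compact_K by (intro compact_Times) auto
  moreover have "((0, 0), axis undefined 1) \<in> ?S" using R_pos by (simp add: K_def norm_axis_1)
  then have "?S \<noteq> {}" by blast
  ultimately obtain p where p: "p \<in> ?S" "\<And>y. y \<in> ?S \<Longrightarrow> q p \<le> q y"
    using continuous_attains_inf[of ?S q] by blast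
  \<comment> \<open>\<open>q p\<close> is the minimum over \<open>K\<close> and unit vectors; off
    \<open>K\<close> the metric is Euclidean with constant 1. Homogeneity extends the bound to all
    v.\<close>
  define c where "c = min 1 (q p)"
  have "snd p \<noteq> 0" using p(1) by auto
  then have "q p > 0" using G_pos[of "snd p" "fst p"] by (simp add: q_def case_prod_beta)
  then have "c > 0" by (simp add: c_def)
  moreover have "c * (norm v)\<^sup>2 \<le> v \<bullet> (G x *v v)" for x v
  proof (cases "v = 0 \<or> x \<notin> K")
    case True
    have "c * (norm v)\<^sup>2 \<le> 1 * (norm v)\<^sup>2"
      by (rule mult_right_mono) (auto simp: c_def)
    with True show ?thesis by (auto simp: G_outside_K dot_square_norm)
  next
    case False
    let ?w = "v /\<^sub>R norm v"
    have "c \<le> q (x, ?w)"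
      using False p(2)[of "(x, ?w)"] by (auto simp: c_def)
    also have "\<dots> = (v \<bullet> (G x *v v)) / (norm v)\<^sup>2"
      by (simp add: q_def matrix_vector_mult_scaleR power2_eq_square divide_simps)
    finally show ?thesis using False by (simp add: pos_le_divide_eq)
  qed
  ultimately show ?thesis by blast
qed

lemma A_bounded: "\<exists>C. \<forall>x v. norm (A x *v v) \<le> C * norm v"
proof -
  obtain c where c: "c > 0" "\<And>x v. c * (norm v)\<^sup>2 \<le> v \<bullet> (G x *v v)" using G_elliptic by blast
  have "norm (A x *v v) \<le> (1 / c) * norm v" for x v
  proof -
    let ?w = "A x *v v"
    have "c * (norm ?w)\<^sup>2 \<le> ?w \<bullet> v" using c(2)[of ?w x] by simp
    also have "\<dots> \<le> norm ?w * norm v" by (rule norm_cauchy_schwarz)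
    finally have "norm ?w * (c * norm ?w) \<le> norm ?w * norm v" by (simp add: power2_eq_square mult_ac)
    then have "c * norm ?w \<le> norm v"
      by (cases "?w = 0") (auto simp: mult_le_cancel_left)
    then show ?thesis using c(1) by (simp add: field_simps)
  qed
  then show ?thesis by blast
qed

lemma norm_A_bounded: "\<exists>C. \<forall>x. norm (A x) \<le> C"
proof -
  obtain C where C: "\<And>x v. norm (A x *v v) \<le> C * norm v" using A_bounded by blast
  have "norm (A x) \<le> (\<Sum>i\<in>(UNIV::'n set). \<Sum>j\<in>(UNIV::'n set). C)" for x
  proof -
    have "norm (A x) \<le> (\<Sum>i\<in>UNIV. norm (A x $ i))"
      unfolding norm_vec_def by (rule L2_set_le_sum) simp
    also have "\<dots> \<le> (\<Sum>i\<in>UNIV. \<Sum>j\<in>UNIV. \<bar>A x $ i $ j\<bar>)"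
      by (intro sum_mono norm_le_l1_cart)
    also have "\<dots> \<le> (\<Sum>i\<in>(UNIV::'n set). \<Sum>j\<in>(UNIV::'n set). C)"
    proof (intro sum_mono)
      fix i j
      have "A x $ i $ j = (A x *v axis j 1) $ i"
        by (simp add: matrix_vector_mult_basis column_def)
      also have "\<bar>\<dots>\<bar> \<le> norm (A x *v axis j 1)" by (rule component_le_norm_cart)
      finally show "\<bar>A x $ i $ j\<bar> \<le> C" using C[of x "axis j 1"] by simp
    qed
    finally show ?thesis .
  qed
  then show ?thesis by blast
qed

text \<open>The resolvent identity. It turns Lipschitz bounds for \<open>G\<close> into Lipschitz
  bounds for the inverse, and applied once more it yields the derivative of the inverse.\<close>

lemma A_diff: "A y - A x = A y ** ((G x - G y) ** A x)"
proof -
  interpret bounded_bilinear "(**) :: real ^ 'n ^ 'n \<Rightarrow> real ^ 'n ^ 'n \<Rightarrow> _"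
    by (rule bounded_bilinear_matrix_matrix_mult)
  show ?thesis by (simp add: diff_left diff_right G_A A_G matrix_mul_assoc)
qed

lemma bounded_lipschitz_A: "bounded_lipschitz A"
proof -
  interpret M: bounded_bilinear "(**) :: real ^ 'n ^ 'n \<Rightarrow> real ^ 'n ^ 'n \<Rightarrow> _"
    by (rule bounded_bilinear_matrix_matrix_mult)
  obtain C where C: "\<And>x. norm (A x) \<le> C" using norm_A_bounded by blast
  obtain D where D: "D \<ge> 0" "\<And>x y. norm (G x - G y) \<le> D * norm (x - y)"
    using bounded_lipschitz_G by (rule bounded_lipschitzE) blast
  obtain k where k: "k \<ge> 0" "\<And>(a :: real ^ 'n ^ 'n) (b :: real ^ 'n ^ 'n). norm (a ** b) \<le> norm a * norm b * k"
    using M.nonneg_bounded by blast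
  have C0: "C \<ge> 0" using C norm_ge_zero order_trans by blast
  show ?thesis
  proof (rule bounded_lipschitzI[OF C])
    fix x y
    have "norm (A x - A y) \<le> norm (A x) * norm ((G y - G x) ** A y) * k"
      unfolding A_diff[of x y] by (rule k)
    also have "\<dots> \<le> C * ((D * norm (y - x)) * C * k) * k"
      by (intro mult_mono C D k order_refl order_trans[OF k(2)] mult_nonneg_nonneg norm_ge_zero)
         (auto simp: C0 D k)
    finally show "norm (A x - A y) \<le> (C * D * C * k * k) * norm (x - y)"
      by (simp add: norm_minus_commute mult_ac)
  qed
qed

text \<open>Replacing the left factor A y in the resolvent identity by A x leaves the remainder
  \<open>E\<close>, a product of an increment of \<open>A\<close> with an increment of
  \<open>G\<close>, which is therefore quadratic in y - x.\<close>

lemma A_deriv: "(A has_derivative (\<lambda>v. - (A x ** (DG x v ** A x)))) (at x)"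
proof -
  interpret M: bounded_bilinear "(**) :: real ^ 'n ^ 'n \<Rightarrow> real ^ 'n ^ 'n \<Rightarrow> _"
    by (rule bounded_bilinear_matrix_matrix_mult)
  define E where "E = (\<lambda>y. (A y - A x) ** ((G x - G y) ** A x))"
  have eq: "A = (\<lambda>y. A x + A x ** ((G x - G y) ** A x) + E y)"
  proof
    fix y
    have "A x ** ((G x - G y) ** A x) + E y = A y ** ((G x - G y) ** A x)"
      unfolding E_def M.diff_left[of "A y" "A x"] by simp
    then show "A y = A x + A x ** ((G x - G y) ** A x) + E y"
      using A_diff[of y x] by (metis add.assoc add.commute diff_add_cancel)
  qed
  obtain C where C: "C \<ge> 0" "\<And>x. norm (A x) \<le> C" "\<And>x y. norm (A x - A y) \<le> C * norm (x - y)"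
    using bounded_lipschitz_A by (rule bounded_lipschitzE) blast
  obtain D where D: "D \<ge> 0" "\<And>x y. norm (G x - G y) \<le> D * norm (x - y)"
    using bounded_lipschitz_G by (rule bounded_lipschitzE) blast
  obtain k where k: "k \<ge> 0" "\<And>(a :: real ^ 'n ^ 'n) (b :: real ^ 'n ^ 'n). norm (a ** b) \<le> norm a * norm b * k"
    using M.nonneg_bounded by blast
  have "(E has_derivative (\<lambda>_. 0)) (at x)"
  proof (rule has_derivative_quadratic_error)
    fix y
    have "norm (E y) \<le> norm (A y - A x) * norm ((G x - G y) ** A x) * k"
      unfolding E_def by (rule k)
    also have "\<dots> \<le> (C * norm (y - x)) * ((D * norm (x - y)) * C * k) * k"
      by (intro mult_mono C D k order_refl order_trans[OF k(2)] mult_nonneg_nonneg norm_ge_zero)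
    finally show "norm (E y) \<le> (C * D * C * k * k) * (norm (y - x))\<^sup>2"
      by (simp add: norm_minus_commute mult_ac power2_eq_square)
  qed (simp add: E_def)
  then have "((\<lambda>y. A x + A x ** ((G x - G y) ** A x) + E y) has_derivative
      (\<lambda>v. 0 + A x ** ((0 - DG x v) ** A x) + 0)) (at x)"
    by (intro has_derivative_add has_derivative_const has_derivative_diff G_deriv
        bounded_linear.has_derivative[OF M.bounded_linear_right]
        bounded_linear.has_derivative[OF M.bounded_linear_left])
  then show ?thesis by (subst eq) (simp add: M.minus_left M.minus_right)
qed

section \<open>The rescaled bicharacteristic flow\<close>

text \<open>In a state \<open>(h, t, z, \<theta>)\<close> the number \<open>h\<close> is the inverse of the frequency.  For \<open>h = 0\<close> the flow is
  the geodesic flow of $g(t)$ with $t$ frozen; for \<open>h > 0\<close> it is the bicharacteristic flow of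
  \<open>symbol g\<close> in the time $\sigma$ with $dt = \frac h2 d\sigma$ and with covector $\zeta = \theta/h$.\<close>

definition field :: "'n state \<Rightarrow> 'n state" where
  "field = (\<lambda>(h, t, z, \<theta>). (0, h / 2, A (t, z) *v \<theta>, force (t, z) (A (t, z) *v \<theta>)))"

text \<open>The nearest-point projection onto a ball is 1-Lipschitz and is the identity on the ball.
  Composing \<open>field\<close> with it removes the quadratic growth in \<theta> without changing
  the equation where |\<theta>| is at most M.\<close>

definition clip :: "real \<Rightarrow> 'n state \<Rightarrow> 'n state" where
  "clip M = (\<lambda>(h, t, z, \<theta>). (h, t, z, closest_point (cball 0 M) \<theta>))"

definition solution :: "(real \<Rightarrow> 'n state) \<Rightarrow> bool" where
  "solution X \<longleftrightarrow> (\<forall>s. (X has_vector_derivative field (X s)) (at s))"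

definition clipped_solution :: "real \<Rightarrow> (real \<Rightarrow> 'n state) \<Rightarrow> bool" where
  "clipped_solution M X \<longleftrightarrow> (\<forall>s. (X has_vector_derivative field (clip M (X s))) (at s))"

lemma clip_id: "norm \<theta> \<le> M \<Longrightarrow> clip M (h, t, z, \<theta>) = (h, t, z, \<theta>)"
  unfolding clip_def by (simp add: closest_point_self)

lemma field_flat: "norm z \<ge> R \<Longrightarrow> field (h, t, z, \<theta>) = (0, h / 2, \<theta>, 0)"
  by (simp add: field_def A_flat force_def B_def DG_zero vec_eq_iff)

text \<open>The variables t and z enter only through the bounded Lipschitz functions
  \<open>A\<close> and \<open>B k\<close>, the covector only through its bounded projection, and h
  only linearly in the t-component; no bound on h, t or z is required.\<close>

lemma clipped_field_lipschitz:
  assumes "M \<ge> 0"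
  obtains L where "\<And>X Y. norm (field (clip M X) - field (clip M Y)) \<le> L * norm (X - Y)"
proof -
  define p :: "'n state \<Rightarrow> real \<times> (real ^ 'n)" where "p = (\<lambda>(h, t, z, \<theta>). (t, z))"
  define c :: "'n state \<Rightarrow> real ^ 'n" where "c = (\<lambda>(h, t, z, \<theta>). closest_point (cball 0 M) \<theta>)"
  have p: "norm (p X - p Y) \<le> norm (X - Y)" for X Y
    by (cases X; cases Y) (simp add: p_def norm_Pair)
  have "norm (closest_point (cball 0 M) v) \<le> M" for v :: "real ^ 'n"
    using closest_point_in_set[of "cball 0 M" v] assms by auto
  then have "bounded_lipschitz (closest_point (cball (0 :: real ^ 'n) M))"
    by (rule bounded_lipschitzI[where L = 1])
       (use closest_point_lipschitz[of "cball (0 :: real ^ 'n) M"] assms in \<open>auto simp: dist_norm\<close>)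
  then have "bounded_lipschitz (\<lambda>X :: 'n state. closest_point (cball 0 M) (snd (snd (snd X))))"
  proof (rule bounded_lipschitz_compose)
    show "norm (snd (snd (snd X)) - snd (snd (snd Y))) \<le> norm (X - Y)" for X Y :: "'n state"
      by (cases X; cases Y) (simp add: norm_Pair real_le_rsqrt)
  qed
  then have c: "bounded_lipschitz c" by (simp add: c_def case_prod_beta')
  define u where "u = (\<lambda>X. A (p X) *v c X)"
  have u: "bounded_lipschitz u"
    unfolding u_def
    by (intro bounded_bilinear.bounded_lipschitz_prod[OF bounded_bilinear_matrix_vector_mult]
        bounded_lipschitz_compose[OF bounded_lipschitz_A] p c)
  have half: "bounded_lipschitz f \<Longrightarrow> bounded_lipschitz (\<lambda>x. f x / 2)" for f :: "'n state \<Rightarrow> real"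
    using bounded_bilinear.bounded_lipschitz_prod[OF bounded_bilinear_mult, of f "\<lambda>_. 1/2"]
      bounded_lipschitzI[of "\<lambda>_ :: 'n state. 1/2 :: real" "1/2" 0] by simp
  have "bounded_lipschitz (\<lambda>X. force (p X) (u X))"
    unfolding force_def
    by (intro bounded_lipschitz_vec half bounded_bilinear.bounded_lipschitz_prod[OF bounded_bilinear_inner]
        bounded_bilinear.bounded_lipschitz_prod[OF bounded_bilinear_matrix_vector_mult]
        bounded_lipschitz_compose[OF bounded_lipschitz_B] p u)
  then obtain D where D: "\<And>X Y. norm (force (p X) (u X) - force (p Y) (u Y)) \<le> D * norm (X - Y)"
    by (rule bounded_lipschitzE) blast
  obtain C where C: "\<And>X Y. norm (u X - u Y) \<le> C * norm (X - Y)"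
    using u by (rule bounded_lipschitzE) blast
  have eq: "field (clip M X) = (0, fst X / 2, u X, force (p X) (u X))" for X
    by (cases X) (simp add: field_def clip_def u_def p_def c_def)
  have "norm (field (clip M X) - field (clip M Y)) \<le> (1 + (C + D)) * norm (X - Y)" for X Y
  proof -
    have "field (clip M X) - field (clip M Y) =
        (0, (fst X - fst Y) / 2, u X - u Y, force (p X) (u X) - force (p Y) (u Y))"
      by (simp add: eq diff_divide_distrib)
    also have "norm \<dots> \<le> norm (0::real) + (norm ((fst X - fst Y) / 2) +
        (norm (u X - u Y) + norm (force (p X) (u X) - force (p Y) (u Y))))"
      by (meson add_left_mono norm_Pair_le order_trans)
    also have "\<dots> \<le> 0 + (1 * norm (X - Y) + (C * norm (X - Y) + D * norm (X - Y)))"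
    proof (intro add_mono C D)
      have "norm (fst X - fst Y) \<le> norm (X - Y)" by (cases X; cases Y) (simp add: norm_Pair real_le_rsqrt)
      then show "norm ((fst X - fst Y) / 2) \<le> 1 * norm (X - Y)" by simp
    qed simp
    finally show ?thesis by (simp add: algebra_simps)
  qed
  then show ?thesis using that by blast
qed

lemma clipped_solution_exists:
  assumes "M \<ge> 0"
  obtains X where "clipped_solution M X" and "X a = X0"
proof -
  obtain L where "\<And>X Y. norm (field (clip M X) - field (clip M Y)) \<le> L * norm (X - Y)"
    using clipped_field_lipschitz[OF assms] by blast
  then obtain x where x: "x 0 = X0" "\<And>t. (x has_vector_derivative field (clip M (x t))) (at t)"
    using lipschitz_ode_solution[of "\<lambda>X. field (clip M X)" L X0] by blast
  have "clipped_solution M (\<lambda>s. x (s - a))"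
    unfolding clipped_solution_def
  proof
    fix s
    have "((\<lambda>s. s - a) has_vector_derivative 1) (at s)" by (auto intro!: derivative_eq_intros)
    from vector_diff_chain_at[OF this x(2)]
    show "((\<lambda>s. x (s - a)) has_vector_derivative field (clip M (x (s - a)))) (at s)"
      by (simp add: o_def)
  qed
  then show ?thesis using that x(1) by force
qed

text \<open>Because h is a component of the state, this estimate also compares a bicharacteristic at
  frequency 1/h with a geodesic at h = 0: the high-frequency limit becomes continuity in the initial
  value. The constant is uniform over all pairs of solutions.\<close>

lemma clipped_solution_continuous_dependence:
  assumes "M \<ge> 0"
  obtains C where "\<And>X Y. clipped_solution M X \<Longrightarrow> clipped_solution M Y \<Longrightarrow>
    (\<And>s. s \<in> {a..b} \<Longrightarrow> norm (X s - Y s) \<le> C * norm (X a - Y a))"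
proof -
  obtain L where L: "\<And>X Y. norm (field (clip M X) - field (clip M Y)) \<le> L * norm (X - Y)"
    using clipped_field_lipschitz[OF assms] by blast
  have L': "norm (field (clip M X) - field (clip M Y)) \<le> \<bar>L\<bar> * norm (X - Y)" for X Y
    by (rule order_trans[OF L]) (simp add: mult_right_mono)
  have "norm (X s - Y s) \<le> exp (\<bar>L\<bar> * (b - a)) * norm (X a - Y a)"
    if "clipped_solution M X" "clipped_solution M Y" "s \<in> {a..b}" for X Y s
  proof -
    have "norm (X s - Y s) \<le> norm (X a - Y a) * exp (\<bar>L\<bar> * (s - a))"
      by (rule lipschitz_ode_forward[OF L']) (use that in \<open>auto simp: clipped_solution_def\<close>)
    also have "\<dots> \<le> norm (X a - Y a) * exp (\<bar>L\<bar> * (b - a))"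
      using that by (intro mult_left_mono) (auto intro: mult_left_mono)
    finally show ?thesis by (simp add: mult.commute)
  qed
  then show ?thesis using that by blast
qed

lemma clipped_solution_parameters:
  assumes "clipped_solution M X"
  shows "fst (X s) = fst (X a)" and "fst (snd (X s)) = fst (snd (X a)) + (s - a) * fst (X a) / 2"
proof -
  have der: "(X has_vector_derivative field (clip M (X s))) (at s)" for s
    using assms by (simp add: clipped_solution_def)
  have fst_field: "fst (field (clip M Y)) = 0" "fst (snd (field (clip M Y))) = fst Y / 2" for Y
    by (simp_all add: field_def clip_def case_prod_beta)
  have d1: "((\<lambda>s. fst (X s)) has_real_derivative 0) (at s)" for s
    using bounded_linear.has_vector_derivative[OF bounded_linear_fst der[of s]]
    by (simp add: has_real_derivative_iff_has_vector_derivative fst_field)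
  then show h: "fst (X s) = fst (X a)" for s
    by (metis (no_types, lifting) DERIV_isconst_all)
  have "((\<lambda>s. fst (snd (X s)) - s * fst (X a) / 2) has_real_derivative 0) (at s)" for s
    using bounded_linear.has_vector_derivative[OF bounded_linear_fst
        bounded_linear.has_vector_derivative[OF bounded_linear_snd der[of s]]]
    by (auto simp: has_real_derivative_iff_has_vector_derivative fst_field h[of s]
        intro!: derivative_eq_intros)
  then have "fst (snd (X s)) - s * fst (X a) / 2 = fst (snd (X a)) - a * fst (X a) / 2"
    by (metis (no_types, lifting) DERIV_isconst_all)
  then show "fst (snd (X s)) = fst (snd (X a)) + (s - a) * fst (X a) / 2"
    by (simp add: field_simps)
qed

text \<open>The condition concerns the explicit line, not the unknown curve: a line outside the open
  ball solves the equation, and uniqueness forces \<open>X\<close> to follow it. The segment may run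
  in either time direction.\<close>

lemma clipped_solution_straight:
  assumes X: "clipped_solution M X" and a: "X a = (h, t, z, \<theta>)" and \<theta>: "norm \<theta> \<le> M"
    and out: "\<And>s. s \<in> closed_segment a b \<Longrightarrow> norm (z + (s - a) *\<^sub>R \<theta>) \<ge> R"
  shows "X b = (h, t + (b - a) * h / 2, z + (b - a) *\<^sub>R \<theta>, \<theta>)"
proof -
  define Y :: "real \<Rightarrow> 'n state"
    where "Y = (\<lambda>s. (h, t + (s - a) * h / 2, z + (s - a) *\<^sub>R \<theta>, \<theta>))"
  have M: "M \<ge> 0" using \<theta> norm_ge_zero order_trans by blast
  obtain L where L: "\<And>X Y. norm (field (clip M X) - field (clip M Y)) \<le> L * norm (X - Y)"
    using clipped_field_lipschitz[OF M] by blast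
  have "X b = Y b"
  proof (rule lipschitz_ode_unique[where F = "\<lambda>X. field (clip M X)", OF L])
    show "X a = Y a" by (simp add: a Y_def)
    show "(X has_vector_derivative field (clip M (X s))) (at s)" for s
      using X by (simp add: clipped_solution_def)
    fix s assume s: "s \<in> closed_segment a b"
    have "field (clip M (Y s)) = (0, h / 2, \<theta>, 0)"
      unfolding Y_def clip_id[OF \<theta>] by (rule field_flat[OF out[OF s]])
    then show "(Y has_vector_derivative field (clip M (Y s))) (at s)"
      unfolding Y_def by (auto intro!: derivative_eq_intros)
  qed
  then show ?thesis by (simp add: Y_def)
qed

lemma solution_clipped:
  assumes "clipped_solution M X" and "\<And>s. norm (snd (snd (snd (X s)))) \<le> M"
  shows "solution X"
  unfolding solution_def
proof
  fix s
  have "clip M (X s) = X s" using assms(2)[of s] clip_id by (cases "X s") simp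
  then show "(X has_vector_derivative field (X s)) (at s)"
    using assms(1) by (metis clipped_solution_def)
qed

lemma clipped_solution_of_solution:
  assumes "solution X" and "\<And>s. norm (snd (snd (snd (X s)))) \<le> M"
  shows "clipped_solution M X"
  unfolding clipped_solution_def
proof
  fix s
  have "clip M (X s) = X s" using assms(2)[of s] clip_id by (cases "X s") simp
  then show "(X has_vector_derivative field (clip M (X s))) (at s)"
    using assms(1) by (metis solution_def)
qed

text \<open>On a compact time interval both covectors are bounded by some M, so there both curves
  solve the clipped equation, which is globally Lipschitz.\<close>

lemma solution_unique:
  assumes X: "solution X" and Y: "solution Y" and "X a = Y a"
  shows "X b = Y b"
proof -
  define \<theta> :: "'n state \<Rightarrow> real ^ 'n" where "\<theta> = (\<lambda>X. snd (snd (snd X)))"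
  have "\<exists>M. \<forall>s\<in>closed_segment a b. norm (\<theta> (W s)) \<le> M" if "solution W" for W
  proof -
    have "continuous_on UNIV W"
      by (rule continuous_on_vector_derivative[OF has_vector_derivative_at_within])
         (use that in \<open>auto simp: solution_def\<close>)
    then have "continuous_on (closed_segment a b) (\<lambda>s. \<theta> (W s))"
      unfolding \<theta>_def by (intro continuous_on_snd) (rule continuous_on_subset, auto)
    from compact_imp_bounded[OF compact_continuous_image[OF this compact_segment]]
    show ?thesis by (auto simp: bounded_iff)
  qed
  then obtain M1 M2 where M: "\<And>s. s \<in> closed_segment a b \<Longrightarrow> norm (\<theta> (X s)) \<le> M1"
    "\<And>s. s \<in> closed_segment a b \<Longrightarrow> norm (\<theta> (Y s)) \<le> M2"
    using X Y by metis
  define M where "M = max (max M1 M2) 0"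
  obtain L where L: "\<And>X Y. norm (field (clip M X) - field (clip M Y)) \<le> L * norm (X - Y)"
    using clipped_field_lipschitz[of M] by (auto simp: M_def)
  have clip: "clip M W = W" if "norm (\<theta> W) \<le> M" for W
    using that clip_id by (cases W) (simp add: \<theta>_def)
  show ?thesis
  proof (rule lipschitz_ode_unique[where F = "\<lambda>X. field (clip M X)", OF L])
    show "X a = Y a" by fact
    fix s assume s: "s \<in> closed_segment a b"
    have "norm (\<theta> (X s)) \<le> M" "norm (\<theta> (Y s)) \<le> M"
      using M[OF s] by (auto simp: M_def)
    then show "(X has_vector_derivative field (clip M (X s))) (at s)"
      "(Y has_vector_derivative field (clip M (Y s))) (at s)"
      using X Y by (simp_all add: clip solution_def)
  qed
qed

section \<open>Energy and the covector form of the geodesic equation\<close>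

lemma DG_coords: "DG x (0, w) = (\<Sum>k\<in>UNIV. (w $ k) *\<^sub>R B k x)"
proof -
  have "(0, w) = (\<Sum>k\<in>UNIV. (w $ k) *\<^sub>R (0 :: real, axis k 1 :: real ^ 'n))"
    using basis_expansion[of w] by (simp add: sum_prod scalar_mult_eq_scaleR)
  then show ?thesis
    unfolding B_def by (simp add: linear_sum[OF linear_DG] linear_cmul[OF linear_DG] del: scaleR_Pair)
qed

lemma force_inner: "force x w \<bullet> v = (w \<bullet> (DG x (0, v) *v w)) / 2"
proof -
  interpret bounded_bilinear "(*v) :: real ^ 'n ^ 'n \<Rightarrow> _" by (rule bounded_bilinear_matrix_vector_mult)
  show ?thesis
    unfolding DG_coords
    by (simp add: force_def inner_vec_def[of "vec_lambda _"] sum_left scaleR_left inner_sum_right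
        sum_divide_distrib mult.commute)
qed

text \<open>This homogeneity absorbs the factor h^2 that arises when both time and covector are
  rescaled.\<close>

lemma force_scale: "force x (c *\<^sub>R w) = c\<^sup>2 *\<^sub>R force x w"
  by (simp add: force_def vec_eq_iff matrix_vector_mult_scaleR power2_eq_square)

lemma A_mult_deriv:
  assumes x: "(x has_vector_derivative x') (at s)" and \<theta>: "(\<theta> has_vector_derivative \<theta>') (at s)"
  shows "((\<lambda>s. A (x s) *v \<theta> s) has_vector_derivative
    A (x s) *v (\<theta>' - DG (x s) x' *v (A (x s) *v \<theta> s))) (at s)"
proof -
  interpret bounded_bilinear "(*v) :: real ^ 'n ^ 'n \<Rightarrow> _" by (rule bounded_bilinear_matrix_vector_mult)
  have "((\<lambda>s. A (x s)) has_vector_derivative - (A (x s) ** (DG (x s) x' ** A (x s)))) (at s)"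
    using has_derivative_compose[OF x[unfolded has_vector_derivative_def] A_deriv]
    unfolding has_vector_derivative_def
    by (rule has_derivative_eq_rhs)
       (simp add: fun_eq_iff linear_cmul[OF linear_DG]
          bounded_bilinear.scaleR_left[OF bounded_bilinear_matrix_matrix_mult]
          bounded_bilinear.scaleR_right[OF bounded_bilinear_matrix_matrix_mult])
  from has_vector_derivative[OF this \<theta>] show ?thesis
    by (simp add: diff_right minus_left matrix_vector_mul_assoc matrix_mul_assoc)
qed

lemma G_mult_deriv:
  assumes x: "(x has_vector_derivative x') (at s)" and w: "(w has_vector_derivative w') (at s)"
  shows "((\<lambda>s. G (x s) *v w s) has_vector_derivative G (x s) *v w' + DG (x s) x' *v w s) (at s)"
proof -
  have "((\<lambda>s. G (x s)) has_vector_derivative DG (x s) x') (at s)"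
    using has_derivative_compose[OF x[unfolded has_vector_derivative_def] G_deriv]
    unfolding has_vector_derivative_def
    by (rule has_derivative_eq_rhs) (simp add: fun_eq_iff linear_cmul[OF linear_DG])
  from bounded_bilinear.has_vector_derivative[OF bounded_bilinear_matrix_vector_mult this w]
  show ?thesis .
qed

lemma energy_deriv:
  assumes x: "(x has_vector_derivative x') (at s)" and \<theta>: "(\<theta> has_vector_derivative \<theta>') (at s)"
  defines "u \<equiv> A (x s) *v \<theta> s"
  shows "((\<lambda>s. \<theta> s \<bullet> (A (x s) *v \<theta> s)) has_real_derivative
    2 * (\<theta>' \<bullet> u) - u \<bullet> (DG (x s) x' *v u)) (at s)"
  using bounded_bilinear.has_vector_derivative[OF bounded_bilinear_inner \<theta> A_mult_deriv[OF x \<theta>]]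
  by (simp add: has_real_derivative_iff_has_vector_derivative u_def inner_A[of "\<theta> s"]
      bounded_bilinear.diff_right[OF bounded_bilinear_matrix_vector_mult]
      inner_diff_right inner_commute)

text \<open>With t frozen the base velocity is (0, u), and by \<open>force_inner\<close> the force
  term cancels the derivative of the inverse metric. The equation is assumed at the single time s
  only, so that the lemma also applies to clipped solutions at times when the clipping is
  inactive.\<close>

lemma frozen_energy_deriv:
  assumes "((\<lambda>s. (0, t s, z s, \<theta> s)) has_vector_derivative field (0, t s, z s, \<theta> s)) (at s)"
  shows "((\<lambda>s. \<theta> s \<bullet> (A (t s, z s) *v \<theta> s)) has_real_derivative 0) (at s)"
proof -
  define u where "u = A (t s, z s) *v \<theta> s"
  note d = assms[unfolded field_def, simplified, folded u_def]
  note d2 = bounded_linear.has_vector_derivative[OF bounded_linear_snd d, simplified]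
  note d3 = bounded_linear.has_vector_derivative[OF bounded_linear_snd d2, simplified]
  have t: "(t has_vector_derivative 0) (at s)"
    using bounded_linear.has_vector_derivative[OF bounded_linear_fst d2] by simp
  have z: "(z has_vector_derivative u) (at s)"
    using bounded_linear.has_vector_derivative[OF bounded_linear_fst d3] by simp
  have \<theta>: "(\<theta> has_vector_derivative force (t s, z s) u) (at s)"
    using bounded_linear.has_vector_derivative[OF bounded_linear_snd d3] by simp
  from energy_deriv[OF has_vector_derivative_Pair[OF t z] \<theta>] show ?thesis
    by (simp add: u_def[symmetric] force_inner)
qed

lemma metric_deriv_eq: "metric_deriv (g t) z i j l = B i (t, z) $ j $ l"
proof -
  have "((\<lambda>w. G (t, w)) has_derivative (\<lambda>v. DG (t, z) (0, v))) (at z)"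
    by (rule has_derivative_compose[OF _ G_deriv]) (auto intro!: derivative_eq_intros)
  then have "((\<lambda>w. G (t, w) $ j $ l) has_derivative (\<lambda>v. DG (t, z) (0, v) $ j $ l)) (at z)"
    by (intro bounded_linear.has_derivative[OF bounded_linear_vec_nth])
  then show ?thesis
    unfolding metric_deriv_def B_def by (subst frechet_derivative_at[symmetric]) (simp_all add: G_def)
qed

text \<open>Contracted with w twice, the first two terms of the Christoffel symbol agree after
  exchanging i and j, and each gives DG(0, w) w; the third gives twice the force. The factor 1/2 and
  the inverse metric then produce the right-hand side.\<close>

lemma geodesic_acceleration:
  "(\<chi> k. - (\<Sum>i\<in>UNIV. \<Sum>j\<in>UNIV. christoffel (g t) z k i j * w $ i * w $ j)) =
    A (t, z) *v (force (t, z) w - DG (t, z) (0, w) *v w)"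
proof -
  define x where "x = (t, z)"
  have sym: "B i x $ j $ l = B i x $ l $ j" for i j l
    using DG_sym[of x "(0, axis i 1)"] by (simp add: B_def transpose_def vec_eq_iff)
  have D: "(\<Sum>i\<in>UNIV. \<Sum>j\<in>UNIV. B i x $ j $ l * w $ i * w $ j) = (DG x (0, w) *v w) $ l" for l
  proof -
    have "(DG x (0, w) *v w) $ l = (\<Sum>j\<in>UNIV. \<Sum>i\<in>UNIV. B i x $ l $ j * w $ i * w $ j)"
      by (simp add: DG_coords matrix_vector_mult_def sum_distrib_left sum_distrib_right mult_ac)
    also have "\<dots> = (\<Sum>i\<in>UNIV. \<Sum>j\<in>UNIV. B i x $ j $ l * w $ i * w $ j)"
      by (subst sum.swap) (simp add: sym)
    finally show ?thesis by simp
  qed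
  have D': "(\<Sum>i\<in>UNIV. \<Sum>j\<in>UNIV. B j x $ i $ l * w $ i * w $ j) = (DG x (0, w) *v w) $ l" for l
    unfolding D[symmetric] by (subst sum.swap) (simp add: mult_ac)
  have F: "(\<Sum>i\<in>UNIV. \<Sum>j\<in>UNIV. B l x $ i $ j * w $ i * w $ j) = 2 * force x w $ l" for l
    by (simp add: force_def inner_vec_def matrix_vector_mult_def sum_distrib_left mult_ac)
  have "- (\<Sum>i\<in>UNIV. \<Sum>j\<in>UNIV. christoffel (g t) z k i j * w $ i * w $ j) =
      (A x *v (force x w - DG x (0, w) *v w)) $ k" for k
  proof -
    have "(\<Sum>i\<in>UNIV. \<Sum>j\<in>UNIV. christoffel (g t) z k i j * w $ i * w $ j) =
        (\<Sum>i\<in>UNIV. \<Sum>j\<in>UNIV. \<Sum>l\<in>UNIV. A x $ k $ l * ((B i x $ j $ l * w $ i * w $ j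
          + B j x $ i $ l * w $ i * w $ j - B l x $ i $ j * w $ i * w $ j) / 2))"
      unfolding christoffel_def metric_deriv_eq x_def[symmetric]
      by (simp add: A_def G_def x_def sum_distrib_left sum_distrib_right algebra_simps
          add_divide_distrib diff_divide_distrib)
    also have "\<dots> = (\<Sum>i\<in>UNIV. \<Sum>l\<in>UNIV. \<Sum>j\<in>UNIV. A x $ k $ l * ((B i x $ j $ l * w $ i * w $ j
          + B j x $ i $ l * w $ i * w $ j - B l x $ i $ j * w $ i * w $ j) / 2))"
      by (intro sum.cong refl sum.swap)
    also have "\<dots> = (\<Sum>l\<in>UNIV. \<Sum>i\<in>UNIV. \<Sum>j\<in>UNIV. A x $ k $ l * ((B i x $ j $ l * w $ i * w $ j
          + B j x $ i $ l * w $ i * w $ j - B l x $ i $ j * w $ i * w $ j) / 2))"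
      by (rule sum.swap)
    also have "\<dots> = (\<Sum>l\<in>UNIV. A x $ k $ l * (((DG x (0, w) *v w) $ l + (DG x (0, w) *v w) $ l
          - 2 * force x w $ l) / 2))"
      unfolding sum_distrib_left[symmetric] sum_divide_distrib[symmetric] sum.distrib sum_subtractf
        D D' F ..
    also have "\<dots> = - (\<Sum>l\<in>UNIV. A x $ k $ l * (force x w - DG x (0, w) *v w) $ l)"
      by (simp add: sum_negf[symmetric] algebra_simps diff_divide_distrib)
    finally show ?thesis by (simp add: matrix_vector_mult_def)
  qed
  then show ?thesis by (simp add: x_def vec_eq_iff)
qed

text \<open>The Legendre transform: lowering the index cancels the term with DG(0, w) in the
  acceleration and leaves only the force.\<close>

lemma geodesic_imp_solution:
  assumes "geodesic (g t) c u"
  shows "solution (\<lambda>s. (0, t, c s, G (t, c s) *v u s))"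
  unfolding solution_def
proof
  fix s
  have c: "(c has_vector_derivative u s) (at s)"
    and u: "(u has_vector_derivative A (t, c s) *v (force (t, c s) (u s) - DG (t, c s) (0, u s) *v u s)) (at s)"
    using assms unfolding geodesic_def geodesic_acceleration by auto
  have "((\<lambda>s. (t, c s)) has_vector_derivative (0, u s)) (at s)"
    by (intro has_vector_derivative_Pair has_vector_derivative_const c)
  from G_mult_deriv[OF this u]
  have "((\<lambda>s. G (t, c s) *v u s) has_vector_derivative force (t, c s) (u s)) (at s)" by simp
  then show "((\<lambda>s. (0, t, c s, G (t, c s) *v u s)) has_vector_derivative
      field (0, t, c s, G (t, c s) *v u s)) (at s)"
    unfolding field_def by (auto intro!: has_vector_derivative_Pair has_vector_derivative_const c)
qed

lemma solution_imp_geodesic: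
  assumes "solution (\<lambda>s. (0, t, z s, \<theta> s))"
  shows "geodesic (g t) z (\<lambda>s. A (t, z s) *v \<theta> s)"
  unfolding geodesic_def geodesic_acceleration
proof (intro allI conjI)
  fix s
  define u where "u = A (t, z s) *v \<theta> s"
  have d: "((\<lambda>s. (0 :: real, t, z s, \<theta> s)) has_vector_derivative (0, 0, u, force (t, z s) u)) (at s)"
    using assms unfolding solution_def field_def u_def by simp
  note d3 = bounded_linear.has_vector_derivative[OF bounded_linear_snd
      bounded_linear.has_vector_derivative[OF bounded_linear_snd d], simplified]
  show z: "(z has_vector_derivative A (t, z s) *v \<theta> s) (at s)"
    using bounded_linear.has_vector_derivative[OF bounded_linear_fst d3] by (simp add: u_def)
  have \<theta>: "(\<theta> has_vector_derivative force (t, z s) u) (at s)"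
    using bounded_linear.has_vector_derivative[OF bounded_linear_snd d3] by simp
  from A_mult_deriv[OF has_vector_derivative_Pair[OF has_vector_derivative_const z] \<theta>]
  show "((\<lambda>s. A (t, z s) *v \<theta> s) has_vector_derivative A (t, z s) *v
      (force (t, z s) (A (t, z s) *v \<theta> s) - DG (t, z s) (0, A (t, z s) *v \<theta> s) *v (A (t, z s) *v \<theta> s))) (at s)"
    by (simp add: u_def)
qed

lemma frozen_energy_const:
  assumes "solution (\<lambda>s. (0, t, z s, \<theta> s))"
  shows "\<theta> a \<bullet> (A (t, z a) *v \<theta> a) = \<theta> b \<bullet> (A (t, z b) *v \<theta> b)"
proof -
  have "((\<lambda>s. \<theta> s \<bullet> (A (t, z s) *v \<theta> s)) has_real_derivative 0) (at s)" for s
    by (rule frozen_energy_deriv) (use assms in \<open>simp add: solution_def\<close>)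
  then show ?thesis by (metis (no_types, lifting) DERIV_isconst_all)
qed

text \<open>With w = A \<theta> the energy is w \<bullet> G w, which dominates |w|^2 by ellipticity,
  while |\<theta>| = |G w| is bounded by a multiple of |w|. The summand 1 in the constant only
  ensures that it is positive.\<close>

lemma A_coercive: "\<exists>C>0. \<forall>x \<theta>. (norm \<theta>)\<^sup>2 \<le> C * (\<theta> \<bullet> (A x *v \<theta>))"
proof -
  interpret M: bounded_bilinear "(*v) :: real ^ 'n ^ 'n \<Rightarrow> _" by (rule bounded_bilinear_matrix_vector_mult)
  obtain c where c: "c > 0" "\<And>x v. c * (norm v)\<^sup>2 \<le> v \<bullet> (G x *v v)" using G_elliptic by blast
  obtain D where D: "D \<ge> 0" "\<And>x. norm (G x) \<le> D"
    using bounded_lipschitz_G by (rule bounded_lipschitzE) blast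
  obtain k where k: "k \<ge> 0" "\<And>(a :: real ^ 'n ^ 'n) (b :: real ^ 'n). norm (a *v b) \<le> norm a * norm b * k"
    using M.nonneg_bounded by blast
  have "(norm \<theta>)\<^sup>2 \<le> ((D * k)\<^sup>2 / c + 1) * (\<theta> \<bullet> (A x *v \<theta>))" for x \<theta>
  proof -
    define w where "w = A x *v \<theta>"
    have \<theta>: "\<theta> = G x *v w" by (simp add: w_def)
    have cw: "c * (norm w)\<^sup>2 \<le> \<theta> \<bullet> w" using c(2)[of w x] by (simp add: \<theta> inner_commute)
    have "norm \<theta> \<le> D * norm w * k"
      unfolding \<theta> by (rule order_trans[OF k(2)]) (intro mult_right_mono D k norm_ge_zero)
    then have "(norm \<theta>)\<^sup>2 \<le> (D * norm w * k)\<^sup>2" by (rule power_mono) simp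
    also have "\<dots> = ((D * k)\<^sup>2 / c) * (c * (norm w)\<^sup>2)"
      using c(1) by (simp add: power_mult_distrib)
    also have "\<dots> \<le> ((D * k)\<^sup>2 / c) * (\<theta> \<bullet> w)"
      using c(1) by (intro mult_left_mono cw) simp
    also have "\<dots> \<le> ((D * k)\<^sup>2 / c + 1) * (\<theta> \<bullet> w)"
      using cw c(1) by (intro mult_right_mono) (auto intro: order_trans[rotated])
    finally show ?thesis by (simp add: w_def)
  qed
  moreover have "(D * k)\<^sup>2 / c + 1 > 0" using c(1) by (simp add: add_nonneg_pos)
  ultimately show ?thesis by blast
qed

text \<open>Conservation of energy keeps the covector away from the clipping threshold.\<close>

lemma geodesic_flow_exists:
  assumes past: "\<And>s. s \<le> 0 \<Longrightarrow> norm (z0 + s *\<^sub>R \<theta>0) \<ge> R"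
  obtains z \<theta> where "solution (\<lambda>s. (0, t, z s, \<theta> s))" and "z 0 = z0" and "\<theta> 0 = \<theta>0"
proof -
  obtain C where C: "C > 0" "\<And>x \<theta>. (norm \<theta>)\<^sup>2 \<le> C * (\<theta> \<bullet> (A x *v \<theta>))" using A_coercive by blast
  define E0 where "E0 = \<theta>0 \<bullet> (A (t, z0) *v \<theta>0)"
  \<comment> \<open>The threshold lies strictly above both the initial covector and the size
    permitted by the initial energy.\<close>
  define M where "M = sqrt (C * E0) + 1 + norm \<theta>0"
  have CE: "C * E0 \<ge> 0" using C(2)[of \<theta>0 "(t, z0)"] zero_le_power2 order_trans unfolding E0_def by blast
  then have M: "M > sqrt (C * E0)" "M > norm \<theta>0" "M > 0" "sqrt (C * E0) \<ge> 0"
    by (auto simp: M_def add_nonneg_pos add_pos_nonneg add.commute add_strict_increasing2)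
  obtain X where X: "clipped_solution M X" "X 0 = (0, t, z0, \<theta>0)"
    using clipped_solution_exists[of M] M(3) by (metis less_imp_le)
  define z where "z = (\<lambda>s. fst (snd (snd (X s))))"
  define \<theta> where "\<theta> = (\<lambda>s. snd (snd (snd (X s))))"
  have Xs: "X = (\<lambda>s. (0, t, z s, \<theta> s))"
    using clipped_solution_parameters[OF X(1), of _ 0] X(2) by (auto simp: z_def \<theta>_def prod_eq_iff)
  have init: "z 0 = z0" "\<theta> 0 = \<theta>0" using X(2) by (simp_all add: z_def \<theta>_def)
  have der: "((\<lambda>s. (0, t, z s, \<theta> s)) has_vector_derivative field (clip M (0, t, z s, \<theta> s))) (at s)" for s
    using X(1) unfolding clipped_solution_def Xs by simp
  note d3 = bounded_linear.has_vector_derivative[OF bounded_linear_snd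
      bounded_linear.has_vector_derivative[OF bounded_linear_snd der], simplified]
  note zd = bounded_linear.has_vector_derivative[OF bounded_linear_fst d3, simplified]
  note \<theta>d = bounded_linear.has_vector_derivative[OF bounded_linear_snd d3, simplified]
  have cont\<theta>: "continuous_on UNIV \<theta>"
    by (rule continuous_on_vector_derivative[OF has_vector_derivative_at_within[OF \<theta>d]])
  define E where "E = (\<lambda>s. \<theta> s \<bullet> (A (t, z s) *v \<theta> s))"
  have contE: "isCont E s" for s
    unfolding E_def
    by (rule DERIV_isCont[OF energy_deriv[OF has_vector_derivative_Pair[OF has_vector_derivative_const zd] \<theta>d]])
  have bound: "norm (\<theta> b) < M" if "b \<ge> 0" for b
  proof (rule ccontr)
    assume "\<not> norm (\<theta> b) < M"
    \<comment> \<open>The least element of \<open>S\<close> is the first time at which the threshold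
      is reached. Before it the clipping is inactive, so the energy is still E0 there, and
      coercivity keeps |\<theta>| below M.\<close>
    define S where "S = {0..b} \<inter> {s. M \<le> norm (\<theta> s)}"
    have "closed {s. M \<le> norm (\<theta> s)}"
      by (intro closed_Collect_le continuous_intros cont\<theta>)
    then have "compact S" unfolding S_def by (intro compact_Int_closed) auto
    moreover have "b \<in> S" using that \<open>\<not> norm (\<theta> b) < M\<close> by (auto simp: S_def)
    ultimately obtain s1 where s1: "s1 \<in> S" "\<And>s. s \<in> S \<Longrightarrow> s1 \<le> s"
      using compact_attains_inf[of S] by blast
    have "s1 \<noteq> 0" using s1(1) M(2) init by (auto simp: S_def)
    then have pos: "0 < s1" using s1(1) by (auto simp: S_def)
    have "E s1 = E 0"
    proof (rule DERIV_isconst_end[OF pos])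
      show "continuous_on {0..s1} E" by (rule continuous_at_imp_continuous_on) (simp add: contE)
      fix s assume s: "0 < s" "s < s1"
      then have "\<not> M \<le> norm (\<theta> s)" using s1(1) s1(2)[of s] by (auto simp: S_def)
      then have "norm (\<theta> s) \<le> M" by simp
      then show "DERIV E s :> 0"
        unfolding E_def using der[of s] by (intro frozen_energy_deriv) (simp add: clip_id)
    qed
    then have "(norm (\<theta> s1))\<^sup>2 \<le> C * E0"
      using C(2)[of "\<theta> s1" "(t, z s1)"] by (simp add: E_def E0_def init)
    then have "norm (\<theta> s1) \<le> sqrt (C * E0)" by (simp add: real_le_rsqrt)
    then show False using s1(1) M(1) by (auto simp: S_def)
  qed
  have "norm (\<theta> s) \<le> M" for s
  proof (cases "s \<ge> 0")
    \<comment> \<open>Backward in time the curve is the line of \<open>past\<close>, along which the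
      covector stays \<theta>0.\<close>
    case False
    have "X s = (0, t + (s - 0) * 0 / 2, z0 + (s - 0) *\<^sub>R \<theta>0, \<theta>0)"
      by (rule clipped_solution_straight[OF X])
         (use M False past in \<open>auto simp: closed_segment_eq_real_ivl\<close>)
    then show ?thesis using M(2) by (simp add: \<theta>_def)
  qed (use bound in \<open>auto intro: less_imp_le\<close>)
  then have "solution X" by (intro solution_clipped[OF X(1)]) (simp add: \<theta>_def)
  then show ?thesis using that init unfolding Xs by blast
qed

section \<open>Bicharacteristics as rescaled solutions\<close>

lemma symbol_eq: "symbol g q \<theta> = fst \<theta> + snd \<theta> \<bullet> (A q *v snd \<theta>)"
  by (simp add: symbol_def A_def G_def case_prod_beta)

lemma symbol_gderiv_fibre: "GDERIV (symbol g q) \<theta> :> (1, 2 *\<^sub>R (A q *v snd \<theta>))"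
proof -
  have lin: "bounded_linear (\<lambda>\<zeta>. A q *v \<zeta>)" by simp
  have "((\<lambda>\<theta>. fst \<theta> + snd \<theta> \<bullet> (A q *v snd \<theta>)) has_derivative
      (\<lambda>d. fst d + (snd \<theta> \<bullet> (A q *v snd d) + snd d \<bullet> (A q *v snd \<theta>)))) (at \<theta>)"
    by (intro has_derivative_add has_derivative_fst has_derivative_snd has_derivative_inner
        has_derivative_ident bounded_linear.has_derivative[OF lin])
  then show ?thesis
    unfolding gderiv_def symbol_eq[abs_def]
    by (rule has_derivative_eq_rhs) (auto simp: inner_A[of "snd \<theta>"] inner_commute)
qed

lemma DG_split: "DG q (a, w) = a *\<^sub>R DG q (1, 0) + DG q (0, w)"
proof -
  have "DG q (a *\<^sub>R (1, 0) + (0, w)) = a *\<^sub>R DG q (1, 0) + DG q (0, w)"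
    by (simp only: linear_add[OF linear_DG] linear_cmul[OF linear_DG])
  then show ?thesis by simp
qed

lemma symbol_gderiv_base:
  fixes q :: "real \<times> (real ^ 'n)" and \<theta> :: "real \<times> (real ^ 'n)"
  defines "u \<equiv> A q *v snd \<theta>"
  shows "GDERIV (\<lambda>q. symbol g q \<theta>) q :> (- (u \<bullet> (DG q (1, 0) *v u)), - (2 *\<^sub>R force q u))"
proof -
  interpret M: bounded_bilinear "(*v) :: real ^ 'n ^ 'n \<Rightarrow> _" by (rule bounded_bilinear_matrix_vector_mult)
  have "((\<lambda>q. fst \<theta> + snd \<theta> \<bullet> (A q *v snd \<theta>)) has_derivative
      (\<lambda>d. 0 + snd \<theta> \<bullet> (- (A q ** (DG q d ** A q)) *v snd \<theta>))) (at q)"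
    by (intro has_derivative_add has_derivative_const has_derivative_inner_right
        bounded_linear.has_derivative[OF M.bounded_linear_left] A_deriv)
  then show ?thesis
    unfolding gderiv_def symbol_eq
  proof (rule has_derivative_eq_rhs, intro ext)
    fix d :: "real \<times> (real ^ 'n)"
    have "DG q d = fst d *\<^sub>R DG q (1, 0) + DG q (0, snd d)"
      using DG_split[of q "fst d" "snd d"] by simp
    then have "u \<bullet> (DG q d *v u) = fst d * (u \<bullet> (DG q (1, 0) *v u)) + 2 * (force q u \<bullet> snd d)"
      by (simp add: M.add_left M.scaleR_left inner_add_right force_inner)
    moreover have "snd \<theta> \<bullet> (- (A q ** (DG q d ** A q)) *v snd \<theta>) = - (u \<bullet> (DG q d *v u))"
      by (simp add: u_def M.minus_left inner_A[of "snd \<theta>"] flip: matrix_vector_mul_assoc)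
    ultimately show "0 + snd \<theta> \<bullet> (- (A q ** (DG q d ** A q)) *v snd \<theta>) =
        d \<bullet> (- (u \<bullet> (DG q (1, 0) *v u)), - (2 *\<^sub>R force q u))"
      by (cases d) (simp add: inner_commute)
  qed
qed

text \<open>Gradients are unique, so the existentially quantified ones can be replaced by explicit
  formulas. The component 1 of the base velocity shows that the curve parameter is t up to
  translation.\<close>

lemma hamilton_curve_iff:
  "hamilton_curve (symbol g) q \<theta> \<longleftrightarrow>
    (\<forall>s. (q has_vector_derivative (1, 2 *\<^sub>R (A (q s) *v snd (\<theta> s)))) (at s) \<and>
      (\<theta> has_vector_derivative ((A (q s) *v snd (\<theta> s)) \<bullet> (DG (q s) (1, 0) *v (A (q s) *v snd (\<theta> s))),
        2 *\<^sub>R force (q s) (A (q s) *v snd (\<theta> s)))) (at s))"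
  (is "_ \<longleftrightarrow> ?R")
proof
  assume H: "hamilton_curve (symbol g) q \<theta>"
  show ?R
  proof
    fix s
    obtain u w where "GDERIV (symbol g (q s)) (\<theta> s) :> u" "GDERIV (\<lambda>q. symbol g q (\<theta> s)) (q s) :> w"
      and "(q has_vector_derivative u) (at s)" "(\<theta> has_vector_derivative - w) (at s)"
      using H unfolding hamilton_curve_def by blast
    moreover have "u = (1, 2 *\<^sub>R (A (q s) *v snd (\<theta> s)))"
      by (rule GDERIV_unique) (fact | rule symbol_gderiv_fibre)+
    moreover have "w = (- ((A (q s) *v snd (\<theta> s)) \<bullet> (DG (q s) (1, 0) *v (A (q s) *v snd (\<theta> s)))),
        - (2 *\<^sub>R force (q s) (A (q s) *v snd (\<theta> s))))"
      by (rule GDERIV_unique) (fact | rule symbol_gderiv_base)+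
    ultimately show "(q has_vector_derivative (1, 2 *\<^sub>R (A (q s) *v snd (\<theta> s)))) (at s) \<and>
      (\<theta> has_vector_derivative ((A (q s) *v snd (\<theta> s)) \<bullet> (DG (q s) (1, 0) *v (A (q s) *v snd (\<theta> s))),
        2 *\<^sub>R force (q s) (A (q s) *v snd (\<theta> s)))) (at s)"
      by simp
  qed
next
  assume R: ?R
  show "hamilton_curve (symbol g) q \<theta>"
    unfolding hamilton_curve_def
  proof
    fix s
    show "\<exists>u w. GDERIV (symbol g (q s)) (\<theta> s) :> u \<and> GDERIV (\<lambda>q. symbol g q (\<theta> s)) (q s) :> w \<and>
        (q has_vector_derivative u) (at s) \<and> (\<theta> has_vector_derivative - w) (at s)"
      by (rule exI, rule exI, intro conjI, rule symbol_gderiv_fibre, rule symbol_gderiv_base)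
         (use R in simp_all)
  qed
qed

text \<open>The substitution s = c + h\<sigma>/2 contributes h/2, which cancels the 2 of Hamilton's
  equations. There remain h u = A(h\<zeta>) for the position and, after multiplying \<zeta> by h,
  h^2 times the force for the covector, which is the force of h u.\<close>

lemma hamilton_curve_imp_solution:
  assumes "hamilton_curve (symbol g) (\<lambda>s. (t s, z s)) (\<lambda>s. (\<tau> s, \<zeta> s))" and "h \<noteq> 0"
  shows "t s = t 0 + s"
    and "solution (\<lambda>\<sigma>. (h, t (c + h * \<sigma> / 2), z (c + h * \<sigma> / 2), h *\<^sub>R \<zeta> (c + h * \<sigma> / 2)))"
proof -
  define u where "u = (\<lambda>s. A (t s, z s) *v \<zeta> s)"
  have q: "((\<lambda>s. (t s, z s)) has_vector_derivative (1, 2 *\<^sub>R u s)) (at s)"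
    and \<theta>: "((\<lambda>s. (\<tau> s, \<zeta> s)) has_vector_derivative
      (u s \<bullet> (DG (t s, z s) (1, 0) *v u s), 2 *\<^sub>R force (t s, z s) (u s))) (at s)" for s
    using assms(1) unfolding hamilton_curve_iff by (auto simp: u_def)
  note t' = bounded_linear.has_vector_derivative[OF bounded_linear_fst q, simplified]
    and z' = bounded_linear.has_vector_derivative[OF bounded_linear_snd q, simplified]
    and \<zeta>' = bounded_linear.has_vector_derivative[OF bounded_linear_snd \<theta>, simplified]
  have "((\<lambda>s. t s - s) has_real_derivative 0) (at s)" for s
    using t'[of s] by (auto simp: has_real_derivative_iff_has_vector_derivative intro!: derivative_eq_intros)
  then have "t s - s = t 0 - 0" by (metis (no_types, lifting) DERIV_isconst_all)
  then show "t s = t 0 + s" by simp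
  show "solution (\<lambda>\<sigma>. (h, t (c + h * \<sigma> / 2), z (c + h * \<sigma> / 2), h *\<^sub>R \<zeta> (c + h * \<sigma> / 2)))"
    unfolding solution_def
  proof
    fix \<sigma>
    define r where "r = (\<lambda>\<sigma>. c + h * \<sigma> / 2)"
    have r: "(r has_vector_derivative h / 2) (at \<sigma>)"
      unfolding r_def has_real_derivative_iff_has_vector_derivative[symmetric]
      by (auto intro!: derivative_eq_intros)
    have chain: "((\<lambda>\<sigma>. f (r \<sigma>)) has_vector_derivative (h / 2) *\<^sub>R f') (at \<sigma>)"
      if "(f has_vector_derivative f') (at (r \<sigma>))" for f :: "real \<Rightarrow> 'b::real_normed_vector" and f'
      using vector_diff_chain_at[OF r that] by (simp add: o_def)
    have "((\<lambda>\<sigma>. h *\<^sub>R \<zeta> (r \<sigma>)) has_vector_derivative h *\<^sub>R (h / 2) *\<^sub>R 2 *\<^sub>R force (t (r \<sigma>), z (r \<sigma>)) (u (r \<sigma>))) (at \<sigma>)"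
      by (intro bounded_linear.has_vector_derivative[OF bounded_linear_scaleR_right] chain \<zeta>')
    then have "((\<lambda>\<sigma>. (h, t (r \<sigma>), z (r \<sigma>), h *\<^sub>R \<zeta> (r \<sigma>))) has_vector_derivative
        (0, (h / 2) *\<^sub>R 1, (h / 2) *\<^sub>R 2 *\<^sub>R u (r \<sigma>), h *\<^sub>R (h / 2) *\<^sub>R 2 *\<^sub>R force (t (r \<sigma>), z (r \<sigma>)) (u (r \<sigma>)))) (at \<sigma>)"
      by (intro has_vector_derivative_Pair has_vector_derivative_const chain t' z')
    then show "((\<lambda>\<sigma>. (h, t (c + h * \<sigma> / 2), z (c + h * \<sigma> / 2), h *\<^sub>R \<zeta> (c + h * \<sigma> / 2))) has_vector_derivative
        field (h, t (c + h * \<sigma> / 2), z (c + h * \<sigma> / 2), h *\<^sub>R \<zeta> (c + h * \<sigma> / 2))) (at \<sigma>)"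
      by (simp add: field_def u_def r_def matrix_vector_mult_scaleR force_scale power2_eq_square)
  qed
qed

text \<open>The dual variable of t is defined so that the symbol vanishes. Its Hamilton equation
  then comes from the energy derivative: the spatial part of DG(1, 2u) is cancelled by the force,
  and minus the time derivative of the metric survives.\<close>

lemma solution_imp_hamilton_curve:
  assumes X: "solution (\<lambda>\<sigma>. (h, t0 + h * \<sigma> / 2, z \<sigma>, \<theta> \<sigma>))" and "h \<noteq> 0"
  defines "Z \<equiv> \<lambda>s. z (2 * (s - t0) / h)" and "\<zeta> \<equiv> \<lambda>s. \<theta> (2 * (s - t0) / h) /\<^sub>R h"
  shows "hamilton_curve (symbol g) (\<lambda>s. (s, Z s)) (\<lambda>s. (- (\<zeta> s \<bullet> (A (s, Z s) *v \<zeta> s)), \<zeta> s))"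
  unfolding hamilton_curve_iff
proof
  fix s
  define \<sigma> where "\<sigma> = 2 * (s - t0) / h"
  define u where "u = A (s, Z s) *v \<zeta> s"
  have ts: "t0 + h * \<sigma> / 2 = s" using \<open>h \<noteq> 0\<close> by (simp add: \<sigma>_def field_simps)
  have u: "A (s, z \<sigma>) *v \<theta> \<sigma> = h *\<^sub>R u"
    by (simp add: \<open>h \<noteq> 0\<close> u_def Z_def \<zeta>_def \<sigma>_def matrix_vector_mult_scaleR)
  have r: "((\<lambda>s. 2 * (s - t0) / h) has_vector_derivative 2 / h) (at s)"
    unfolding has_real_derivative_iff_has_vector_derivative[symmetric]
    by (auto intro!: derivative_eq_intros simp: \<open>h \<noteq> 0\<close>)
  have "((\<lambda>\<sigma>. (h, t0 + h * \<sigma> / 2, z \<sigma>, \<theta> \<sigma>)) has_vector_derivative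
      (0, h / 2, h *\<^sub>R u, h\<^sup>2 *\<^sub>R force (s, z \<sigma>) u)) (at \<sigma>)"
    using X[unfolded solution_def, rule_format, of \<sigma>] by (simp add: field_def ts u force_scale)
  note d3 = bounded_linear.has_vector_derivative[OF bounded_linear_snd
      bounded_linear.has_vector_derivative[OF bounded_linear_snd this], simplified]
  have z: "(Z has_vector_derivative 2 *\<^sub>R u) (at s)"
    using vector_diff_chain_at[OF r bounded_linear.has_vector_derivative[OF bounded_linear_fst d3, unfolded \<sigma>_def]]
      \<open>h \<noteq> 0\<close> by (simp add: Z_def o_def)
  have \<zeta>: "(\<zeta> has_vector_derivative 2 *\<^sub>R force (s, Z s) u) (at s)"
    using bounded_linear.has_vector_derivative[OF bounded_linear_scaleR_right
        vector_diff_chain_at[OF r bounded_linear.has_vector_derivative[OF bounded_linear_snd d3, unfolded \<sigma>_def]],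
        of "inverse h"] \<open>h \<noteq> 0\<close>
    by (simp add: \<zeta>_def o_def Z_def power2_eq_square field_simps)
  have q: "((\<lambda>s. (s, Z s)) has_vector_derivative (1, 2 *\<^sub>R u)) (at s)"
    by (intro has_vector_derivative_Pair has_vector_derivative_id z)
  have DG: "DG (s, Z s) (1, 2 *\<^sub>R u) = DG (s, Z s) (1, 0) + 2 *\<^sub>R DG (s, Z s) (0, u)"
    using DG_split[of "(s, Z s)" 1 "2 *\<^sub>R u"] linear_cmul[OF linear_DG, of _ 2 "(0, u)"] by simp
  have "u \<bullet> (DG (s, Z s) (1, 2 *\<^sub>R u) *v u) = u \<bullet> (DG (s, Z s) (1, 0) *v u) + 2 * (u \<bullet> (DG (s, Z s) (0, u) *v u))"
    unfolding DG
    by (simp add: bounded_bilinear.add_left[OF bounded_bilinear_matrix_vector_mult]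
        bounded_bilinear.scaleR_left[OF bounded_bilinear_matrix_vector_mult] inner_add_right)
  then have "((\<lambda>s. \<zeta> s \<bullet> (A (s, Z s) *v \<zeta> s)) has_vector_derivative
      - (u \<bullet> (DG (s, Z s) (1, 0) *v u))) (at s)"
    using energy_deriv[OF q \<zeta>]
    by (simp add: u_def[symmetric] force_inner has_real_derivative_iff_has_vector_derivative)
  then have "((\<lambda>s. (- (\<zeta> s \<bullet> (A (s, Z s) *v \<zeta> s)), \<zeta> s)) has_vector_derivative
      (- (- (u \<bullet> (DG (s, Z s) (1, 0) *v u))), 2 *\<^sub>R force (s, Z s) u)) (at s)"
    by (intro has_vector_derivative_Pair has_vector_derivative_minus \<zeta>)
  with q show "((\<lambda>s. (s, Z s)) has_vector_derivative
        (1, 2 *\<^sub>R (A (s, Z s) *v snd (- (\<zeta> s \<bullet> (A (s, Z s) *v \<zeta> s)), \<zeta> s)))) (at s) \<and>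
      ((\<lambda>s. (- (\<zeta> s \<bullet> (A (s, Z s) *v \<zeta> s)), \<zeta> s)) has_vector_derivative
        ((A (s, Z s) *v snd (- (\<zeta> s \<bullet> (A (s, Z s) *v \<zeta> s)), \<zeta> s)) \<bullet>
          (DG (s, Z s) (1, 0) *v (A (s, Z s) *v snd (- (\<zeta> s \<bullet> (A (s, Z s) *v \<zeta> s)), \<zeta> s))),
        2 *\<^sub>R force (s, Z s) (A (s, Z s) *v snd (- (\<zeta> s \<bullet> (A (s, Z s) *v \<zeta> s)), \<zeta> s)))) (at s)"
    by (simp add: u_def)
qed

end

section \<open>Limits in the compactified 1-cusp bundle\<close>

definition perp :: "'a::real_inner \<Rightarrow> 'a \<Rightarrow> 'a" where
  "perp z v = z - (z \<bullet> v) *\<^sub>R v"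

lemma perp_inner: "norm v = 1 \<Longrightarrow> perp z v \<bullet> v = 0"
  by (simp add: perp_def inner_diff_left dot_square_norm)

lemma norm_add_orthogonal:
  fixes p v :: "'a::real_inner"
  assumes "p \<bullet> v = 0" and "norm v = 1"
  shows "(norm (p + s *\<^sub>R v))\<^sup>2 = (norm p)\<^sup>2 + s\<^sup>2"
  using assms by (simp add: power2_norm_eq_inner inner_add_left inner_add_right inner_commute
      norm_eq_sqrt_inner power2_eq_square)

lemma radial_tendsto [tendsto_intros]: "(f \<longlongrightarrow> a) F \<Longrightarrow> ((\<lambda>x. radial (f x)) \<longlongrightarrow> radial a) F"
proof -
  have "sqrt (1 + (norm a)\<^sup>2) \<noteq> 0"
    by (smt (verit) real_sqrt_eq_zero_cancel_iff zero_le_power2)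
  then show "(f \<longlongrightarrow> a) F \<Longrightarrow> ((\<lambda>x. radial (f x)) \<longlongrightarrow> radial a) F"
    unfolding radial_def bracket_def by (intro tendsto_intros)
qed

lemma norm_radial: "(norm (radial Z))\<^sup>2 = (norm Z)\<^sup>2 / (1 + (norm Z)\<^sup>2)"
  by (simp add: radial_def bracket_def power_mult_distrib power_inverse field_simps abs_of_nonneg)

lemma one_minus_norm_radial: "1 - (norm (radial Z))\<^sup>2 = 1 / (1 + (norm Z)\<^sup>2)"
proof -
  have "1 + (norm Z)\<^sup>2 > 0" by (simp add: add_pos_nonneg)
  then show ?thesis unfolding norm_radial by (simp add: field_simps)
qed

lemma norm_radial_less: "norm (radial Z) < 1"
proof -
  have "1 - (norm (radial Z))\<^sup>2 > 0"
    unfolding one_minus_norm_radial by (simp add: add_pos_nonneg)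
  then have "(norm (radial Z))\<^sup>2 < 1\<^sup>2" by simp
  then show ?thesis by (rule power2_less_imp_less) simp
qed

lemma radial_inverse: "Z = radial Z /\<^sub>R sqrt (1 - (norm (radial Z))\<^sup>2)"
proof -
  have "1 + (norm Z)\<^sup>2 > 0" by (simp add: add_pos_nonneg)
  then show ?thesis
    unfolding one_minus_norm_radial by (simp add: radial_def bracket_def real_sqrt_divide)
qed

lemma radial_inj: "radial Z = radial W \<Longrightarrow> Z = W"
  using radial_inverse by metis

text \<open>\<open>radial\<close> is a homeomorphism onto the open unit ball, with the explicit
  inverse of \<open>radial_inverse\<close>, which is continuous as long as the norm of the limit is
  less than 1.\<close>

lemma tendsto_of_radial:
  assumes "((\<lambda>x. radial (f x)) \<longlongrightarrow> radial a) F"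
  shows "(f \<longlongrightarrow> a) F"
proof -
  have "1 - (norm (radial a))\<^sup>2 > 0"
    unfolding one_minus_norm_radial by (simp add: add_pos_nonneg)
  then have "((\<lambda>x. radial (f x) /\<^sub>R sqrt (1 - (norm (radial (f x)))\<^sup>2)) \<longlongrightarrow>
      radial a /\<^sub>R sqrt (1 - (norm (radial a))\<^sup>2)) F"
    by (intro tendsto_intros assms) simp
  then show ?thesis by (simp flip: radial_inverse)
qed

text \<open>The covector has a component of size 1/h along the base point, and this is the component
  that the 1-cusp frame divides by the bracket of Z. With c = h times that bracket, the division
  turns a/h into a/c, which is regular at h = 0; of \<beta> only the part orthogonal to v survives
  in the limit.\<close>

lemma onec_embed_tendsto:
  fixes \<Theta> \<beta> :: "'b \<Rightarrow> 'a::real_inner"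
  assumes h0: "\<forall>\<^sub>F q in F. h q > 0" and h: "(h \<longlongrightarrow> 0) F"
    and \<Theta>: "(\<Theta> \<longlongrightarrow> v) F" and v: "norm v = 1"
    and a: "(a \<longlongrightarrow> a0) F" and \<beta>: "(\<beta> \<longlongrightarrow> \<beta>0) F"
  shows "((\<lambda>q. onec_embed (\<Theta> q /\<^sub>R h q, (a q / h q) *\<^sub>R \<Theta> q + \<beta> q)) \<longlongrightarrow>
    (v, radial (a0 *\<^sub>R v + perp \<beta>0 v))) F"
proof -
  define c where "c = (\<lambda>q. sqrt ((h q)\<^sup>2 + (norm (\<Theta> q))\<^sup>2))"
  have c: "(c \<longlongrightarrow> sqrt (0\<^sup>2 + (norm v)\<^sup>2)) F"
    unfolding c_def by (intro tendsto_intros h \<Theta>)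
  then have c1: "(c \<longlongrightarrow> 1) F" using v by simp
  define B1 where "B1 = (\<lambda>q. \<Theta> q /\<^sub>R c q)"
  \<comment> \<open>\<open>B1\<close> and \<open>B2\<close> are the embedded coordinates with all
    powers of h cancelled; they remain continuous at h = 0, where c = 1.\<close>
  define B2 where "B2 = (\<lambda>q. a q *\<^sub>R \<Theta> q /\<^sub>R c q + (\<beta> q - ((\<Theta> q \<bullet> \<beta> q) / (c q * (h q + c q))) *\<^sub>R \<Theta> q))"
  have eq: "onec_embed (\<Theta> q /\<^sub>R h q, (a q / h q) *\<^sub>R \<Theta> q + \<beta> q) = (B1 q, radial (B2 q))" if "h q > 0" for q
  proof -
    define Z where "Z = \<Theta> q /\<^sub>R h q"
    have cpos: "c q > 0" using that by (simp add: c_def add_pos_nonneg)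
    have "(c q / h q)\<^sup>2 = 1 + (norm Z)\<^sup>2"
      using that by (simp add: c_def Z_def power_divide power_mult_distrib power_inverse field_simps)
    then have b: "bracket Z = c q / h q"
      unfolding bracket_def using that cpos by (intro real_sqrt_unique) auto
    have r: "radial Z = B1 q" using that by (simp add: radial_def b B1_def) (simp add: Z_def divide_inverse)
    define m where "m = 1 / (c q * (h q + c q))"
    have bb: "1 / (bracket Z * (1 + bracket Z)) = (h q)\<^sup>2 * m"
      unfolding b m_def using that cpos by (simp add: field_simps power2_eq_square)
    have oc: "onec_coord Z V = V - (m * (\<Theta> q \<bullet> V)) *\<^sub>R \<Theta> q" for V
    proof -
      have "onec_coord Z V = V - ((Z \<bullet> V) * (1 / (bracket Z * (1 + bracket Z)))) *\<^sub>R Z"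
        by (simp add: onec_coord_def)
      also have "\<dots> = V - ((Z \<bullet> V) * ((h q)\<^sup>2 * m)) *\<^sub>R Z"
        by (simp only: bb)
      also have "\<dots> = V - (m * (\<Theta> q \<bullet> V)) *\<^sub>R \<Theta> q"
        unfolding Z_def using that by (simp add: power2_eq_square)
      finally show ?thesis .
    qed
    \<comment> \<open>From c^2 = h^2 + |\<Theta>|^2 one gets 1 - m|\<Theta>|^2 = h/c, the factor
      that removes the singular 1/h.\<close>
    have "(norm (\<Theta> q))\<^sup>2 = (c q - h q) * (h q + c q)"
      using that by (simp add: c_def algebra_simps power2_eq_square[symmetric])
    then have "m * (norm (\<Theta> q))\<^sup>2 = (c q - h q) / c q"
      unfolding m_def using that cpos by simp
    then have mm: "1 - m * (norm (\<Theta> q))\<^sup>2 = h q / c q"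
      using cpos by (simp add: diff_divide_distrib)
    have "onec_coord Z ((a q / h q) *\<^sub>R \<Theta> q + \<beta> q) =
        ((a q / h q) * (1 - m * (norm (\<Theta> q))\<^sup>2)) *\<^sub>R \<Theta> q + (\<beta> q - (m * (\<Theta> q \<bullet> \<beta> q)) *\<^sub>R \<Theta> q)"
      unfolding oc by (simp add: algebra_simps inner_add_right dot_square_norm)
    also have "\<dots> = ((a q / h q) * (h q / c q)) *\<^sub>R \<Theta> q + (\<beta> q - (m * (\<Theta> q \<bullet> \<beta> q)) *\<^sub>R \<Theta> q)"
      by (simp only: mm)
    also have "\<dots> = B2 q"
      unfolding B2_def m_def using that by (simp add: divide_inverse mult_ac)
    finally show ?thesis unfolding onec_embed_def Z_def[symmetric] by (simp add: r)
  qed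
  have "(B1 \<longlongrightarrow> v /\<^sub>R 1) F"
    unfolding B1_def by (intro tendsto_intros \<Theta> c1) simp
  moreover have "(B2 \<longlongrightarrow> a0 *\<^sub>R v /\<^sub>R 1 + (\<beta>0 - ((v \<bullet> \<beta>0) / (1 * (0 + 1))) *\<^sub>R v)) F"
    unfolding B2_def by (intro tendsto_intros a \<Theta> \<beta> c1 h) simp_all
  ultimately have "((\<lambda>q. (B1 q, radial (B2 q))) \<longlongrightarrow> (v, radial (a0 *\<^sub>R v + perp \<beta>0 v))) F"
    by (auto intro!: tendsto_Pair radial_tendsto simp: perp_def inner_commute)
  moreover have "\<forall>\<^sub>F q in F. (B1 q, radial (B2 q)) = onec_embed (\<Theta> q /\<^sub>R h q, (a q / h q) *\<^sub>R \<Theta> q + \<beta> q)"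
    using h0 by eventually_elim (simp add: eq)
  ultimately show ?thesis by (simp add: tendsto_cong)
qed

text \<open>Limits along the filter are unique only if it is proper. Properness means that the
  boundary point is approached from the interior of the bundle, and
  \<open>onec_embed_tendsto\<close> with h = 1/(n+1) supplies such a sequence.\<close>

lemma filtercomap_onec_embed_ne_bot:
  fixes v W :: "'a::real_inner"
  assumes v: "norm v = 1"
  shows "filtercomap onec_embed (nhds (v, radial W)) \<noteq> bot"
proof
  assume bot: "filtercomap onec_embed (nhds (v, radial W)) = bot"
  define q where "q = (\<lambda>n. (v /\<^sub>R (1 / real (Suc n)), ((W \<bullet> v) / (1 / real (Suc n))) *\<^sub>R v + perp W v))"
  have "(\<lambda>n. onec_embed (q n)) \<longlonglongrightarrow> (v, radial ((W \<bullet> v) *\<^sub>R v + perp (perp W v) v))"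
    unfolding q_def using v LIMSEQ_Suc[OF lim_1_over_n]
    by (intro onec_embed_tendsto) auto
  also have "(W \<bullet> v) *\<^sub>R v + perp (perp W v) v = W"
    using perp_inner[OF v, of W] by (simp add: perp_def[of "perp W v"]) (simp add: perp_def)
  finally have "filterlim q (filtercomap onec_embed (nhds (v, radial W))) sequentially"
    by (simp add: filterlim_filtercomap_iff o_def)
  then show False
    unfolding bot using filtermap_bot_iff[of q sequentially] by (simp add: filterlim_def le_bot)
qed

text \<open>These are the limits of the 1-cusp coordinates: \<open>h\<close> is x, h (Z' \<bullet>
  y) is -\<xi>, and \<open>perp\<close> of Z' is \<eta>. Thus W = \<eta> - \<xi> v is split into its
  parts along and orthogonal to v.\<close>

lemma onec_embed_filter_limits:
  fixes v W :: "'a::real_inner"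
  assumes v: "norm v = 1"
  defines "F \<equiv> filtercomap onec_embed (nhds (v, radial W))"
  defines "h \<equiv> \<lambda>q :: 'a \<times> 'a. 1 / norm (fst q)"
  defines "y \<equiv> \<lambda>q :: 'a \<times> 'a. fst q /\<^sub>R norm (fst q)"
  shows "\<forall>\<^sub>F q in F. fst q \<noteq> 0" and "(h \<longlongrightarrow> 0) F" and "(y \<longlongrightarrow> v) F"
    and "((\<lambda>q. h q * (snd q \<bullet> y q)) \<longlongrightarrow> W \<bullet> v) F"
    and "((\<lambda>q. perp (snd q) (y q)) \<longlongrightarrow> perp W v) F"
proof -
  have "((\<lambda>q. onec_embed q) \<longlongrightarrow> (v, radial W)) F"
    unfolding F_def by (rule filterlim_filtercomap)
  then have lim: "((\<lambda>q. (radial (fst q), radial (onec_coord (fst q) (snd q)))) \<longlongrightarrow> (v, radial W)) F"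
    by (simp add: onec_embed_def case_prod_beta')
  have \<rho>: "((\<lambda>q. radial (fst q)) \<longlongrightarrow> v) F"
    using tendsto_fst[OF lim] by simp
  define w where "w = (\<lambda>q :: 'a \<times> 'a. onec_coord (fst q) (snd q))"
  have w: "(w \<longlongrightarrow> W) F"
    by (rule tendsto_of_radial) (use tendsto_snd[OF lim] in \<open>simp add: w_def\<close>)
  have "v \<noteq> 0" using v by auto
  have "\<forall>\<^sub>F q in F. radial (fst q) \<noteq> 0"
    by (rule tendsto_imp_eventually_ne[OF \<rho> \<open>v \<noteq> 0\<close>])
  then show ne: "\<forall>\<^sub>F q in F. fst q \<noteq> 0"
    by eventually_elim (auto simp: radial_def)
  \<comment> \<open>This expression equals 1/|Z| in terms of the compactified point and, unlike
    1/|Z| itself, is continuous up to the unit sphere.\<close>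
  have "((\<lambda>q. sqrt (1 - (norm (radial (fst q)))\<^sup>2) / norm (radial (fst q))) \<longlongrightarrow>
      sqrt (1 - (norm v)\<^sup>2) / norm v) F"
    by (intro tendsto_intros \<rho>) (use v in auto)
  moreover have "\<forall>\<^sub>F q in F. sqrt (1 - (norm (radial (fst q)))\<^sup>2) / norm (radial (fst q)) = h q"
    using ne
  proof eventually_elim
    case (elim q)
    have "norm (radial (fst q)) = norm (fst q) / sqrt (1 + (norm (fst q))\<^sup>2)"
      by (simp add: radial_def bracket_def divide_inverse mult.commute abs_of_nonneg)
    moreover have "1 + (norm (fst q))\<^sup>2 > 0" by (simp add: add_pos_nonneg)
    ultimately show ?case
      unfolding one_minus_norm_radial using elim by (simp add: h_def real_sqrt_divide)
  qed
  ultimately show h: "(h \<longlongrightarrow> 0) F" using v by (simp add: tendsto_cong)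
  have "((\<lambda>q. radial (fst q) /\<^sub>R norm (radial (fst q))) \<longlongrightarrow> v /\<^sub>R norm v) F"
    by (intro tendsto_intros \<rho>) (use v in auto)
  moreover have "radial Z /\<^sub>R norm (radial Z) = Z /\<^sub>R norm Z" for Z :: 'a
  proof -
    have "bracket Z > 0" by (simp add: bracket_def add_pos_nonneg)
    then show ?thesis by (simp add: radial_def)
  qed
  ultimately show y: "(y \<longlongrightarrow> v) F" using v by (simp add: y_def)
  have polar: "w q = perp (snd q) (y q) + (h q * (snd q \<bullet> y q) / sqrt (1 + (h q)\<^sup>2)) *\<^sub>R y q \<and> norm (y q) = 1"
    if "fst q \<noteq> 0" for q
    using onec_coord_polar[OF that, of "snd q"] that
    by (simp add: w_def perp_def h_def y_def)
  have wy: "w q \<bullet> y q = h q * (snd q \<bullet> y q) / sqrt (1 + (h q)\<^sup>2)" if "fst q \<noteq> 0" for q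
    using polar[OF that] perp_inner[of "y q" "snd q"] by (simp add: inner_add_left dot_square_norm)
  have pos: "sqrt (1 + (h q)\<^sup>2) > 0" for q by (simp add: add_pos_nonneg)
  have "((\<lambda>q. (w q \<bullet> y q) * sqrt (1 + (h q)\<^sup>2)) \<longlongrightarrow> (W \<bullet> v) * sqrt (1 + 0\<^sup>2)) F"
    by (intro tendsto_intros w y h)
  moreover have "\<forall>\<^sub>F q in F. (w q \<bullet> y q) * sqrt (1 + (h q)\<^sup>2) = h q * (snd q \<bullet> y q)"
    using ne by eventually_elim (use pos in \<open>simp add: wy less_imp_neq[symmetric]\<close>)
  ultimately show "((\<lambda>q. h q * (snd q \<bullet> y q)) \<longlongrightarrow> W \<bullet> v) F"
    by (simp add: tendsto_cong)
  have "((\<lambda>q. w q - (w q \<bullet> y q) *\<^sub>R y q) \<longlongrightarrow> W - (W \<bullet> v) *\<^sub>R v) F"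
    by (intro tendsto_intros w y)
  moreover have "\<forall>\<^sub>F q in F. w q - (w q \<bullet> y q) *\<^sub>R y q = perp (snd q) (y q)"
    using ne by eventually_elim (metis polar wy add_diff_cancel_right')
  ultimately show "((\<lambda>q. perp (snd q) (y q)) \<longlongrightarrow> perp W v) F"
    by (simp add: tendsto_cong perp_def[of W])
qed

section \<open>Boundary values of the scattering map\<close>

text \<open>Following a line away from the origin does not decrease the norm. Negative s covers the
  backward continuation of an incoming line.\<close>

lemma norm_outgoing_le:
  fixes z \<theta> :: "'a::real_inner"
  assumes "s * (z \<bullet> \<theta>) \<ge> 0"
  shows "norm z \<le> norm (z + s *\<^sub>R \<theta>)"
proof (rule power2_le_imp_le)
  have "(norm (z + s *\<^sub>R \<theta>))\<^sup>2 = (norm z)\<^sup>2 + 2 * (s * (z \<bullet> \<theta>)) + s\<^sup>2 * (norm \<theta>)\<^sup>2"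
    unfolding power2_norm_eq_inner by (simp add: algebra_simps inner_commute power2_eq_square)
  then show "(norm z)\<^sup>2 \<le> (norm (z + s *\<^sub>R \<theta>))\<^sup>2" using assms by simp
qed simp

context flat_family
begin

lemma solution_shift:
  assumes "solution X"
  shows "solution (\<lambda>s. X (s + a))"
  unfolding solution_def
proof
  fix s
  have "((\<lambda>s. s + a) has_vector_derivative 1) (at s)" by (auto intro!: derivative_eq_intros)
  from vector_diff_chain_at[OF this, of X] show "((\<lambda>s. X (s + a)) has_vector_derivative field (X (s + a))) (at s)"
    using assms by (simp add: solution_def o_def)
qed

lemma frozen_solution_bounded:
  assumes "solution (\<lambda>s. (0, t, z s, \<theta> s))"
  obtains M where "\<And>s. norm (\<theta> s) \<le> M"
proof -
  obtain C where C: "C > 0" "\<And>x \<theta>. (norm \<theta>)\<^sup>2 \<le> C * (\<theta> \<bullet> (A x *v \<theta>))" using A_coercive by blast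
  have "norm (\<theta> s) \<le> sqrt (C * (\<theta> 0 \<bullet> (A (t, z 0) *v \<theta> 0)))" for s
    using C(2)[of "\<theta> s" "(t, z s)"] frozen_energy_const[OF assms, of s 0] by (simp add: real_le_rsqrt)
  then show ?thesis using that by blast
qed

lemma frozen_solution_straight:
  assumes X: "solution (\<lambda>s. (0, t, z s, \<theta> s))"
    and out: "\<And>s. s \<in> closed_segment a b \<Longrightarrow> norm (z a + (s - a) *\<^sub>R \<theta> a) \<ge> R"
  shows "z b = z a + (b - a) *\<^sub>R \<theta> a" and "\<theta> b = \<theta> a"
proof -
  obtain M where M: "\<And>s. norm (\<theta> s) \<le> M" using frozen_solution_bounded[OF X] by blast
  have X': "clipped_solution M (\<lambda>s. (0, t, z s, \<theta> s))"
    by (rule clipped_solution_of_solution[OF X]) (simp add: M)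
  have "(0, t, z b, \<theta> b) = (0, t + (b - a) * 0 / 2, z a + (b - a) *\<^sub>R \<theta> a, \<theta> a)"
    using clipped_solution_straight[OF X', of a 0 t "z a" "\<theta> a" b] M out by simp
  then show "z b = z a + (b - a) *\<^sub>R \<theta> a" "\<theta> b = \<theta> a" by auto
qed

text \<open>Outside the open ball the conserved energy is the squared Euclidean norm, so unit speed
  on entry gives unit speed on exit.\<close>

lemma frozen_solution_norm_eq:
  assumes X: "solution (\<lambda>s. (0, t, z s, \<theta> s))" and "norm (z a) \<ge> R" "norm (z b) \<ge> R"
  shows "norm (\<theta> a) = norm (\<theta> b)"
  using frozen_energy_const[OF X, of a b] assms(2,3) by (simp add: A_flat dot_square_norm)

text \<open>A clipped solution on the interval from -R to S already determines the scattering data: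
  before it the line with foot -\<eta> is outside the ball, and after it the curve is outgoing. The
  result is read off by writing the outgoing line as 2tP - P'. The bound \<open>mid\<close> is a
  hypothesis because for h > 0 it cannot be derived from conservation of energy.\<close>

lemma classical_map_eq:
  fixes Z Z' :: "real ^ 'n" and S :: real
  assumes Z: "Z \<noteq> 0"
  defines "h \<equiv> 1 / norm Z" and "y \<equiv> Z /\<^sub>R norm Z"
  defines "t1 \<equiv> h * (Z' \<bullet> y) / 2" and "\<eta> \<equiv> perp Z' y"
  assumes X: "clipped_solution M X" and M: "M \<ge> 1"
    and init: "X (- R) = (h, t1 - h * R / 2, - \<eta> - R *\<^sub>R y, y)"
    and mid: "\<And>s. s \<in> {-R..S} \<Longrightarrow> norm (snd (snd (snd (X s)))) \<le> M" and S: "- R \<le> S"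
    and fin: "X S = (h, tS, zS, \<Theta>)" "norm zS \<ge> R" "zS \<bullet> \<Theta> \<ge> 0"
  shows "classical_map g (Z, Z') = (\<Theta> /\<^sub>R h, (2 * t1 / h) *\<^sub>R \<Theta> + (S *\<^sub>R \<Theta> - zS))"
proof -
  have h: "h > 0" using Z by (simp add: h_def)
  have y: "norm y = 1" using Z by (simp add: y_def)
  have Zy: "Z = y /\<^sub>R h" using Z by (simp add: y_def h_def)
  have Z': "Z' = \<eta> + (2 * t1 / h) *\<^sub>R y"
    using h by (simp add: \<eta>_def perp_def t1_def)
  \<comment> \<open>Since \<eta> is orthogonal to y, the point -\<eta> + r y has norm at least |r|;
    this is why -R can serve as starting parameter for every \<eta>.\<close>
  have past: "X s = (h, t1 + h * s / 2, - \<eta> + s *\<^sub>R y, y)" if "s \<le> - R" for s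
  proof -
    have "norm (- \<eta> - R *\<^sub>R y + (r - - R) *\<^sub>R y) \<ge> R" if "r \<le> - R" for r
    proof (rule power2_le_imp_le)
      have eq: "- \<eta> - R *\<^sub>R y + (r - - R) *\<^sub>R y = - \<eta> + r *\<^sub>R y" by (simp add: algebra_simps)
      have "(norm (- \<eta> - R *\<^sub>R y + (r - - R) *\<^sub>R y))\<^sup>2 = (norm (- \<eta>))\<^sup>2 + r\<^sup>2"
        unfolding eq using norm_add_orthogonal[of "- \<eta>" y r] perp_inner[OF y, of Z'] y by (simp add: \<eta>_def)
      moreover have "R\<^sup>2 \<le> r\<^sup>2" using that R_pos by (simp add: abs_le_square_iff[symmetric])
      ultimately show "R\<^sup>2 \<le> (norm (- \<eta> - R *\<^sub>R y + (r - - R) *\<^sub>R y))\<^sup>2"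
        by (simp add: add_increasing)
    qed simp
    then have "X s = (h, t1 - h * R / 2 + (s - - R) * h / 2, - \<eta> - R *\<^sub>R y + (s - - R) *\<^sub>R y, y)"
      using that y M by (intro clipped_solution_straight[OF X init])
        (auto simp: closed_segment_eq_real_ivl split: if_splits)
    then show ?thesis by (simp add: algebra_simps add_divide_distrib)
  qed
  have \<Theta>: "norm \<Theta> \<le> M" using mid[of S] S fin(1) by simp
  have future: "X s = (h, tS + (s - S) * h / 2, zS + (s - S) *\<^sub>R \<Theta>, \<Theta>)" if "s \<ge> S" for s
  proof (rule clipped_solution_straight[OF X fin(1) \<Theta>])
    fix r assume "r \<in> closed_segment S s"
    then have "(r - S) * (zS \<bullet> \<Theta>) \<ge> 0"
      using that fin(3) by (auto simp: closed_segment_eq_real_ivl)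
    from norm_outgoing_le[OF this] show "norm (zS + (r - S) *\<^sub>R \<Theta>) \<ge> R" using fin(2) by linarith
  qed
  have "norm (snd (snd (snd (X s)))) \<le> M" for s
    using past[of s] future[of s] mid[of s] \<Theta> M y by (cases "s \<le> - R"; cases "s \<ge> S") auto
  then have sol: "solution X" by (rule solution_clipped[OF X])
  define z where "z = (\<lambda>s. fst (snd (snd (X s))))"
  define \<theta> where "\<theta> = (\<lambda>s. snd (snd (snd (X s))))"
  have Xs: "X s = (h, t1 + h * s / 2, z s, \<theta> s)" for s
  proof -
    have "fst (X s) = h" "fst (snd (X s)) = t1 + h * s / 2"
      using clipped_solution_parameters[OF X, of s "- R"] init by (simp_all add: field_simps)
    then show ?thesis by (simp add: z_def \<theta>_def prod_eq_iff)
  qed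
  have zp: "z s = - \<eta> + s *\<^sub>R y" "\<theta> s = y" if "s \<le> - R" for s
    using past[OF that] by (simp_all add: z_def \<theta>_def)
  have zf: "z s = zS + (s - S) *\<^sub>R \<Theta>" "\<theta> s = \<Theta>" if "s \<ge> S" for s
    using future[OF that] by (simp_all add: z_def \<theta>_def)
  \<comment> \<open>The asymptotic lines of the definition, rewritten in the time \<sigma> = 2(s -
    t1)/h.\<close>
  have lineZ: "(2 * s) *\<^sub>R Z - Z' = - \<eta> + (2 * (s - t1) / h) *\<^sub>R y" for s
    unfolding Z' using h by (simp add: Zy algebra_simps diff_divide_distrib divide_inverse)
  define P where "P = \<Theta> /\<^sub>R h"
  define P' where "P' = (2 * t1 / h) *\<^sub>R \<Theta> + (S *\<^sub>R \<Theta> - zS)"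
  have lineP: "(2 * s) *\<^sub>R P - P' = zS + (2 * (s - t1) / h - S) *\<^sub>R \<Theta>" for s
    using h by (simp add: P_def P'_def algebra_simps diff_divide_distrib divide_inverse)
  have \<sigma>: "2 * (s - t1) / h \<le> r \<longleftrightarrow> s \<le> t1 + h * r / 2" "r \<le> 2 * (s - t1) / h \<longleftrightarrow> t1 + h * r / 2 \<le> s" for s r
    using h by (auto simp: field_simps)
  have scat: "scatters g (Z, Z') (P, P')"
  proof -
    define \<zeta> where "\<zeta> = (\<lambda>s. \<theta> (2 * (s - t1) / h) /\<^sub>R h)"
    define w where "w = (\<lambda>s. z (2 * (s - t1) / h))"
    have "solution (\<lambda>s. (h, t1 + h * s / 2, z s, \<theta> s))" using sol by (simp flip: Xs)
    then have H: "hamilton_curve (symbol g) (\<lambda>s. (s, w s)) (\<lambda>s. (- (\<zeta> s \<bullet> (A (s, w s) *v \<zeta> s)), \<zeta> s))"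
      unfolding \<zeta>_def w_def by (rule solution_imp_hamilton_curve) (use h in simp)
    have "\<forall>s. s \<le> t1 + h * (- R) / 2 \<longrightarrow> \<zeta> s = Z \<and> w s = (2 * s) *\<^sub>R Z - Z'"
      unfolding \<sigma>(1)[symmetric] lineZ by (auto simp: \<zeta>_def w_def zp Zy)
    moreover have "\<forall>s. s \<ge> t1 + h * S / 2 \<longrightarrow> \<zeta> s = P \<and> w s = (2 * s) *\<^sub>R P - P'"
      unfolding \<sigma>(2)[symmetric] lineP by (auto simp: \<zeta>_def w_def zf P_def)
    ultimately show ?thesis
      unfolding scatters_def prod.case
      by (intro exI[of _ "\<lambda>s. s"] exI[of _ w] exI[of _ "\<lambda>s. - (\<zeta> s \<bullet> (A (s, w s) *v \<zeta> s))"] exI[of _ \<zeta>])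
         (use H in \<open>auto simp: symbol_eq\<close>)
  qed
  \<comment> \<open>The competing curve may have a different end covector and a shifted parameter.
    Aligned in time, it coincides with \<open>X\<close> on the incoming line and hence everywhere,
    so its outgoing data agree.\<close>
  have uniq: "q = (P, P')" if sc: "scatters g (Z, Z') q" for q
  proof -
    obtain Q Q' where q: "q = (Q, Q')" by (cases q)
    obtain t w \<tau> \<zeta> where H: "hamilton_curve (symbol g) (\<lambda>s. (t s, w s)) (\<lambda>s. (\<tau> s, \<zeta> s))"
      and "\<exists>a. \<forall>s. t s \<le> a \<longrightarrow> \<zeta> s = Z \<and> w s = (2 * t s) *\<^sub>R Z - Z'"
      and "\<exists>b. \<forall>s. t s \<ge> b \<longrightarrow> \<zeta> s = Q \<and> w s = (2 * t s) *\<^sub>R Q - Q'"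
      using sc unfolding q scatters_def prod.case by blast
    then obtain a b where a: "\<And>s. t s \<le> a \<Longrightarrow> \<zeta> s = Z \<and> w s = (2 * t s) *\<^sub>R Z - Z'"
      and b: "\<And>s. t s \<ge> b \<Longrightarrow> \<zeta> s = Q \<and> w s = (2 * t s) *\<^sub>R Q - Q'" by metis
    have h0: "h \<noteq> 0" using h by simp
    note t = hamilton_curve_imp_solution(1)[OF H h0]
    define r where "r = (\<lambda>s. t1 - t 0 + h * s / 2)"
    have tr: "t (r s) = t1 + h * s / 2" for s unfolding t[of "r s"] by (simp add: r_def)
    have Y: "solution (\<lambda>s. (h, t1 + h * s / 2, w (r s), h *\<^sub>R \<zeta> (r s)))"
      using hamilton_curve_imp_solution(2)[OF H h0, of "t1 - t 0"]
      unfolding tr[unfolded r_def] by (simp add: r_def)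
    \<comment> \<open>Early enough for both curves to be on their prescribed incoming line;
      \<open>s1\<close> below plays the same part on the outgoing side.\<close>
    define s0 where "s0 = min (- R) (2 * (a - t1) / h)"
    have s0: "s0 \<le> - R" "t1 + h * s0 / 2 \<le> a"
      using \<sigma>(2)[of s0 a] by (auto simp: s0_def)
    have "X s0 = (h, t1 + h * s0 / 2, w (r s0), h *\<^sub>R \<zeta> (r s0))"
      using a[of "r s0"] s0 h unfolding Xs tr lineZ by (simp add: zp Zy)
    then have eq: "X s = (h, t1 + h * s / 2, w (r s), h *\<^sub>R \<zeta> (r s))" for s
      by (rule solution_unique[OF sol Y])
    define s1 where "s1 = max S (2 * (b - t1) / h)"
    have s1: "s1 \<ge> S" "t1 + h * s1 / 2 \<ge> b"
      using \<sigma>(1)[of b s1] by (auto simp: s1_def)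
    have e: "z s1 = w (r s1)" "\<theta> s1 = h *\<^sub>R \<zeta> (r s1)"
      using eq[of s1] unfolding Xs by auto
    have w: "\<zeta> (r s1) = Q" "w (r s1) = (2 * (t1 + h * s1 / 2)) *\<^sub>R Q - Q'"
      using b[of "r s1"] s1(2) unfolding tr by auto
    have "h *\<^sub>R Q = \<Theta>" using e(2) unfolding w zf(2)[OF s1(1)] by simp
    moreover have "(2 * (t1 + h * s1 / 2)) *\<^sub>R Q - Q' = zS + (s1 - S) *\<^sub>R \<Theta>"
      using e(1) unfolding w zf(1)[OF s1(1)] by simp
    moreover from calculation(1) have QP: "Q = P" using h by (auto simp: P_def)
    moreover have "2 * (t1 + h * s1 / 2 - t1) / h = s1" using h by simp
    ultimately have "(2 * (t1 + h * s1 / 2)) *\<^sub>R P - Q' = (2 * (t1 + h * s1 / 2)) *\<^sub>R P - P'"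
      using lineP[of "t1 + h * s1 / 2"] by (simp only:)
    moreover have "a = b" if "x - a = x - b" for x a b :: "real ^ 'n"
      using that by simp
    ultimately have "Q' = P'" by blast
    with QP show ?thesis by (simp add: q)
  qed
  show ?thesis
    unfolding classical_map_def P_def[symmetric] P'_def[symmetric] using scat uniq by blast
qed

text \<open>The geodesic at frozen time t0 with incoming line {p + s v} is the limit of the rescaled
  bicharacteristics near the boundary point with \<xi> = -2 t0 and \<eta> = -p. Strictness of the
  two inequalities at S makes them open conditions, which pass to those nearby curves.\<close>

lemma classical_map_ext_eq:
  assumes X: "solution (\<lambda>s. (0, t0, c s, \<theta> s))"
    and past: "c (- R) = p - R *\<^sub>R v" "\<theta> (- R) = v" and p: "p \<bullet> v = 0" and v: "norm v = 1"
    and S: "- R \<le> S" and fin: "norm (c S) > R" "c S \<bullet> \<theta> S > 0" "norm (\<theta> S) = 1"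
  shows "classical_map_ext g (v, radial ((2 * t0) *\<^sub>R v - p)) =
    (\<theta> S, radial ((2 * t0) *\<^sub>R \<theta> S - perp (c S) (\<theta> S)))"
proof -
  define W where "W = (2 * t0) *\<^sub>R v - p"
  have Wv: "W \<bullet> v = 2 * t0" "perp W v = - p"
    using p v by (simp_all add: W_def inner_diff_left dot_square_norm perp_def)
  define F where "F = filtercomap onec_embed (nhds (v, radial W))"
  define h where "h = (\<lambda>q :: (real ^ 'n) \<times> (real ^ 'n). 1 / norm (fst q))"
  define y where "y = (\<lambda>q :: (real ^ 'n) \<times> (real ^ 'n). fst q /\<^sub>R norm (fst q))"
  define t1 where "t1 = (\<lambda>q. h q * (snd q \<bullet> y q) / 2)"
  define \<eta> where "\<eta> = (\<lambda>q. perp (snd q) (y q))"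
  note l = onec_embed_filter_limits[OF v, of W, folded F_def, unfolded Wv]
  have lims: "\<forall>\<^sub>F q in F. fst q \<noteq> 0" "(h \<longlongrightarrow> 0) F" "(y \<longlongrightarrow> v) F"
    "((\<lambda>q. h q * (snd q \<bullet> y q)) \<longlongrightarrow> 2 * t0) F" "((\<lambda>q. perp (snd q) (y q)) \<longlongrightarrow> - p) F"
    unfolding h_def y_def by (rule l)+
  have t1: "(t1 \<longlongrightarrow> t0) F"
    using tendsto_divide[OF lims(4) tendsto_const[of 2]] by (simp add: t1_def[abs_def])
  have \<eta>: "(\<eta> \<longlongrightarrow> - p) F" using lims(5) by (simp add: \<eta>_def)
  obtain M0 where M0: "\<And>s. norm (\<theta> s) \<le> M0" using frozen_solution_bounded[OF X] by blast
  define M where "M = M0 + 1"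
  have "norm (\<theta> s) \<le> M" for s using M0[of s] by (simp add: M_def)
  then have X': "clipped_solution M (\<lambda>s. (0, t0, c s, \<theta> s))"
    by (intro clipped_solution_of_solution[OF X]) simp
  have M1: "M \<ge> 1" using order_trans[OF norm_ge_zero M0] by (simp add: M_def)
  define init where "init = (\<lambda>q. (h q, t1 q - h q * R / 2, - \<eta> q - R *\<^sub>R y q, y q))"
  define d where "d = (\<lambda>q. norm (init q - (0, t0, c (- R), \<theta> (- R))))"
  have init: "(init \<longlongrightarrow> (0, t0 - 0 * R / 2, - (- p) - R *\<^sub>R v, v)) F"
    unfolding init_def by (intro tendsto_intros lims t1 \<eta>) simp
  have "(d \<longlongrightarrow> norm ((0 :: real, t0 - 0 * R / 2, - (- p) - R *\<^sub>R v, v) - (0, t0, c (- R), \<theta> (- R)))) F"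
    unfolding d_def by (intro tendsto_intros init)
  then have d: "(d \<longlongrightarrow> 0) F" by (simp add: past)
  have "\<exists>Y. clipped_solution M Y \<and> Y (- R) = init q" for q
    using clipped_solution_exists[of M] M1 by (metis order_trans zero_le_one)
  then obtain Y where Y: "\<And>q. clipped_solution M (Y q)" "\<And>q. Y q (- R) = init q" by metis
  obtain C where C: "\<And>X Y s. clipped_solution M X \<Longrightarrow> clipped_solution M Y \<Longrightarrow>
      s \<in> {- R..S} \<Longrightarrow> norm (X s - Y s) \<le> C * norm (X (- R) - Y (- R))"
    using clipped_solution_continuous_dependence[of M "- R" S] M1 by auto
  have close: "norm (Y q s - (0, t0, c s, \<theta> s)) \<le> C * d q" if "s \<in> {- R..S}" for q s
    using C[OF Y(1) X' that, of q] by (simp add: Y(2) d_def)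
  have Cd: "((\<lambda>q. C * d q) \<longlongrightarrow> 0) F" using tendsto_mult_right_zero[OF d] by simp
  have "((\<lambda>q. Y q S - (0, t0, c S, \<theta> S)) \<longlongrightarrow> 0) F"
    by (rule Lim_null_comparison[OF _ Cd]) (use close S in auto)
  then have YS: "((\<lambda>q. Y q S) \<longlongrightarrow> (0, t0, c S, \<theta> S)) F" by (simp add: LIM_zero_iff)
  define zS where "zS = (\<lambda>q. fst (snd (snd (Y q S))))"
  define \<Theta> where "\<Theta> = (\<lambda>q. snd (snd (snd (Y q S))))"
  have zS: "(zS \<longlongrightarrow> c S) F" 
    using tendsto_fst[OF tendsto_snd[OF tendsto_snd[OF YS]]] by (simp add: zS_def[abs_def])
  have \<Theta>: "(\<Theta> \<longlongrightarrow> \<theta> S) F" 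
    using tendsto_snd[OF tendsto_snd[OF tendsto_snd[OF YS]]] by (simp add: \<Theta>_def[abs_def])
  have "\<forall>\<^sub>F q in F. C * d q < 1" by (rule order_tendstoD(2)[OF Cd]) simp
  moreover have "\<forall>\<^sub>F q in F. norm (zS q) > R"
    by (rule order_tendstoD(1)[OF tendsto_norm[OF zS] fin(1)])
  moreover have "\<forall>\<^sub>F q in F. zS q \<bullet> \<Theta> q > 0"
    by (rule order_tendstoD(1)[OF tendsto_inner[OF zS \<Theta>] fin(2)])
  ultimately have cm: "\<forall>\<^sub>F q in F. classical_map g q =
      (\<Theta> q /\<^sub>R h q, (2 * t1 q / h q) *\<^sub>R \<Theta> q + (S *\<^sub>R \<Theta> q - zS q))"
    using lims(1)
  proof eventually_elim
    case (elim q)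
    have "classical_map g (fst q, snd q) =
        (\<Theta> q /\<^sub>R (1 / norm (fst q)), (2 * (1 / norm (fst q) * (snd q \<bullet> (fst q /\<^sub>R norm (fst q))) / 2) /
          (1 / norm (fst q))) *\<^sub>R \<Theta> q + (S *\<^sub>R \<Theta> q - zS q))"
    proof (rule classical_map_eq[OF elim(4) Y(1) M1 _ _ S])
      show "Y q (- R) = (1 / norm (fst q), 1 / norm (fst q) * (snd q \<bullet> (fst q /\<^sub>R norm (fst q))) / 2
          - 1 / norm (fst q) * R / 2, - perp (snd q) (fst q /\<^sub>R norm (fst q)) - R *\<^sub>R (fst q /\<^sub>R norm (fst q)),
          fst q /\<^sub>R norm (fst q))"
        unfolding Y(2) init_def \<eta>_def t1_def h_def y_def ..
      show "norm (zS q) \<ge> R" "zS q \<bullet> \<Theta> q \<ge> 0" using elim by auto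
      have "fst (Y q S) = h q"
        using clipped_solution_parameters(1)[OF Y(1), of q S "- R"] by (simp add: Y(2) init_def)
      then show "Y q S = (1 / norm (fst q), fst (snd (Y q S)), zS q, \<Theta> q)"
        by (simp add: zS_def \<Theta>_def h_def prod_eq_iff)
      fix s assume s: "s \<in> {- R..S}"
      have "norm (snd (snd (snd (Y q s - (0, t0, c s, \<theta> s))))) \<le> norm (Y q s - (0, t0, c s, \<theta> s))"
        by (cases "Y q s") (simp add: norm_Pair real_le_rsqrt)
      also have "\<dots> < 1" using close[OF s, of q] elim(1) by linarith
      finally show "norm (snd (snd (snd (Y q s)))) \<le> M"
        using M0[of s] norm_triangle_sub[of "snd (snd (snd (Y q s)))" "\<theta> s"] by (simp add: M_def)
    qed
    then show ?case by (simp add: t1_def h_def y_def)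
  qed
  have "((\<lambda>q. onec_embed (\<Theta> q /\<^sub>R h q, (2 * t1 q / h q) *\<^sub>R \<Theta> q + (S *\<^sub>R \<Theta> q - zS q))) \<longlongrightarrow>
      (\<theta> S, radial ((2 * t0) *\<^sub>R \<theta> S + perp (S *\<^sub>R \<theta> S - c S) (\<theta> S)))) F"
  proof (rule onec_embed_tendsto[OF _ lims(2) \<Theta> fin(3)])
    show "\<forall>\<^sub>F q in F. h q > 0" using lims(1) by eventually_elim (simp add: h_def)
  qed (intro tendsto_intros t1 \<Theta> zS)+
  \<comment> \<open>The parameter S only moves along the outgoing line and disappears from the
    orthogonal part.\<close>
  moreover have "perp (S *\<^sub>R \<theta> S - c S) (\<theta> S) = - perp (c S) (\<theta> S)"
    using fin(3) by (simp add: perp_def inner_diff_left dot_square_norm algebra_simps)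
  ultimately have "((\<lambda>q. onec_embed (classical_map g q)) \<longlongrightarrow>
      (\<theta> S, radial ((2 * t0) *\<^sub>R \<theta> S - perp (c S) (\<theta> S)))) F"
    using cm by (subst tendsto_cong[where g = "\<lambda>q. onec_embed (\<Theta> q /\<^sub>R h q, (2 * t1 q / h q) *\<^sub>R \<Theta> q + (S *\<^sub>R \<Theta> q - zS q))"])
      (auto elim: eventually_mono)
  moreover have "F \<noteq> bot" unfolding F_def by (rule filtercomap_onec_embed_ne_bot[OF v])
  ultimately show ?thesis
    unfolding classical_map_ext_def W_def[symmetric] F_def[symmetric] by (intro tendsto_Lim)
qed

section \<open>Truncated scattering and asymptotic lines\<close>

lemma truncated_scattering_imp_ext:
  assumes "((t, z, v), (t', z', v')) \<in> truncated_scattering g R T"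
  shows "classical_map_ext g (v, radial ((2 * t) *\<^sub>R v - perp z v)) =
    (v', radial ((2 * t) *\<^sub>R v' - perp z' v'))"
proof -
  obtain c u s where z: "norm z = R" "norm v = 1" "v \<bullet> z < 0" and z': "norm z' = R" "norm v' = 1" "v' \<bullet> z' > 0"
    and c: "geodesic (g t) c u" "c 0 = z" "g t z *v u 0 = v" "s > 0" "c s = z'" "g t z' *v u s = v'"
    using assms by (auto simp: truncated_scattering_def boundary_in_def boundary_out_def)
  define \<theta> where "\<theta> = (\<lambda>s. G (t, c s) *v u s)"
  have sol: "solution (\<lambda>s. (0, t, c s, \<theta> s))"
    using geodesic_imp_solution[OF c(1)] by (simp add: \<theta>_def)
  have \<theta>: "\<theta> 0 = v" "\<theta> s = v'" using c by (simp_all add: \<theta>_def G_def)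
  \<comment> \<open>An inward unit covector on the sphere points away from the origin when followed
    backward, so the geodesic extends into the past as a line outside the ball.\<close>
  have past: "c r = z + r *\<^sub>R v" "\<theta> r = v" if "r \<le> 0" for r
  proof -
    have "norm (c 0 + (q - 0) *\<^sub>R \<theta> 0) \<ge> R" if "q \<in> closed_segment 0 r" for q
    proof -
      have "q \<le> 0" using that \<open>r \<le> 0\<close> by (auto simp: closed_segment_eq_real_ivl split: if_splits)
      then have "q * (z \<bullet> v) \<ge> 0"
        using z by (intro mult_nonpos_nonpos) (auto simp: inner_commute)
      from norm_outgoing_le[OF this] show ?thesis using z c(2) \<theta> by simp
    qed
    from frozen_solution_straight[OF sol this] show "c r = z + r *\<^sub>R v" "\<theta> r = v"
      using c(2) \<theta> by simp_all
  qed
  \<comment> \<open>The curve is followed one unit beyond its exit because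
    \<open>classical_map_ext_eq\<close> asks for a norm strictly greater than R.\<close>
  have future: "c (s + 1) = z' + v'" "\<theta> (s + 1) = v'"
  proof -
    have "norm (c s + (q - s) *\<^sub>R \<theta> s) \<ge> R" if "q \<in> closed_segment s (s + 1)" for q
      using norm_outgoing_le[of "q - s" z' v'] that z' c(5) \<theta>
      by (auto simp: closed_segment_eq_real_ivl inner_commute)
    from frozen_solution_straight[OF sol this] show "c (s + 1) = z' + v'" "\<theta> (s + 1) = v'"
      using c(5) \<theta> by simp_all
  qed
  \<comment> \<open>Since z = \<open>perp z v\<close> + a v, shifting the parameter by a puts the
    foot of the incoming line at 0. The bound -R \<le> a places the parameter -R on the straight
    part.\<close>
  define a where "a = z \<bullet> v"
  have a: "- R \<le> a" "a < 0"
    using Cauchy_Schwarz_ineq2[of z v] z by (auto simp: a_def inner_commute)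
  have "classical_map_ext g (v, radial ((2 * t) *\<^sub>R v - perp z v)) =
      (\<theta> (s + 1 + a + - a), radial ((2 * t) *\<^sub>R \<theta> (s + 1 + a + - a) - perp (c (s + 1 + a + - a)) (\<theta> (s + 1 + a + - a))))"
  proof (rule classical_map_ext_eq[OF solution_shift[OF sol, of "- a"]])
    show "c (- R + - a) = perp z v - R *\<^sub>R v" "\<theta> (- R + - a) = v"
      using past[of "- R + - a"] a by (simp_all add: perp_def a_def algebra_simps)
    show "- R \<le> s + 1 + a" using a c(4) by simp
    have "(norm (z' + v'))\<^sup>2 = (norm z')\<^sup>2 + 2 * (v' \<bullet> z') + (norm v')\<^sup>2"
      unfolding power2_norm_eq_inner by (simp add: inner_add_left inner_add_right inner_commute)
    then have "R\<^sup>2 < (norm (z' + v'))\<^sup>2" using z' by simp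
    then show "R < norm (c (s + 1 + a + - a))"
      by (simp add: future) (rule power2_less_imp_less, auto)
    show "c (s + 1 + a + - a) \<bullet> \<theta> (s + 1 + a + - a) > 0"
      using z' by (simp add: future inner_add_left inner_add_right inner_commute dot_square_norm)
  qed (use z z' perp_inner in \<open>auto simp: future\<close>)
  moreover have "perp (z' + v') v' = perp z' v'"
    using z' by (simp add: perp_def inner_add_left dot_square_norm algebra_simps)
  ultimately show ?thesis by (simp add: future)
qed

text \<open>Non-trapping forces the geodesic out of the ball, and the first time after entry at
  which it is no longer inside is the exit. It remains to check that this time is positive and that
  the crossing is genuinely outward.\<close>

lemma truncated_scattering_total:
  assumes b: "(t, z, v) \<in> boundary_in R T" and nt: "nontrapping (g t)"
  obtains z' v' where "((t, z, v), (t, z', v')) \<in> truncated_scattering g R T"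
proof -
  have t: "t \<in> {-T..T}" and zv: "norm z = R" "norm v = 1" "v \<bullet> z < 0"
    using b by (auto simp: boundary_in_def)
  have "norm (z + s *\<^sub>R v) \<ge> R" if "s \<le> 0" for s
    using norm_outgoing_le[of s z v] that zv by (simp add: inner_commute mult_nonpos_nonpos)
  then obtain c \<theta> where sol: "solution (\<lambda>s. (0, t, c s, \<theta> s))" and c0: "c 0 = z" "\<theta> 0 = v"
    using geodesic_flow_exists[of z v t] by blast
  define u where "u = (\<lambda>s. A (t, c s) *v \<theta> s)"
  have geo: "geodesic (g t) c u" unfolding u_def by (rule solution_imp_geodesic[OF sol])
  have gu: "g t (c s) *v u s = \<theta> s" for s
    using G_A_vec[of "(t, c s)" "\<theta> s"] by (simp add: u_def G_def)
  have u0: "u 0 = v" using zv by (simp add: u_def c0 A_flat)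
  have cder: "(c has_vector_derivative u s) (at s)" for s using geo by (simp add: geodesic_def)
  have contc: "continuous_on UNIV c"
    by (rule continuous_on_vector_derivative[OF has_vector_derivative_at_within[OF cder]])
  \<comment> \<open>The squared norm has derivative 2 (v \<bullet> z) < 0 at 0, so the curve enters
    the open ball at once.\<close>
  have "((\<lambda>s. c s \<bullet> c s) has_real_derivative 2 * (v \<bullet> z)) (at 0)"
    using bounded_bilinear.has_vector_derivative[OF bounded_bilinear_inner cder cder, of 0]
    by (simp add: has_real_derivative_iff_has_vector_derivative c0 u0 inner_commute)
  from DERIV_neg_dec_right[OF this] obtain \<epsilon> where \<epsilon>: "\<epsilon> > 0" "\<And>s. 0 < s \<Longrightarrow> s < \<epsilon> \<Longrightarrow> c s \<bullet> c s < z \<bullet> z"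
    using zv c0 by auto
  have inside: "norm (c s) < R" if "0 < s" "s < \<epsilon>" for s
    using \<epsilon>(2)[OF that] zv by (simp add: norm_lt[symmetric])
  have "\<exists>s. u s \<noteq> 0" using u0 zv(2) by (intro exI[of _ 0]) auto
  then have "\<forall>\<^sub>F s in at_infinity. c s \<notin> cball 0 R"
    using nt geo compact_cball unfolding nontrapping_def by blast
  then obtain b where "\<And>s. b \<le> norm s \<Longrightarrow> c s \<notin> cball 0 R"
    unfolding eventually_at_infinity by blast
  then have out: "norm (c (max b \<epsilon>)) > R"
    by (metis linorder_not_le max.cobounded1 abs_ge_self mem_cball_0 order_trans real_norm_def)
  \<comment> \<open>Starting at \<epsilon>/2 excludes the entry point, which also lies on the
    sphere.\<close>
  define S where "S = {\<epsilon> / 2..max b \<epsilon>} \<inter> {s. R \<le> norm (c s)}"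
  have "closed {s. R \<le> norm (c s)}"
    by (intro closed_Collect_le continuous_intros contc)
  then have "compact S" unfolding S_def by (intro compact_Int_closed) auto
  moreover have "max b \<epsilon> \<in> S" using out \<epsilon>(1) by (auto simp: S_def)
  ultimately obtain s where s: "s \<in> S" "\<And>r. r \<in> S \<Longrightarrow> s \<le> r"
    using compact_attains_inf[of S] by blast
  have s_pos: "s > 0" and cs: "norm (c s) \<ge> R" using s(1) \<epsilon>(1) by (auto simp: S_def)
  have before: "norm (c r) < R" if "0 < r" "r < s" for r
  proof (cases "r < \<epsilon>")
    case False
    have "r \<notin> S" using s(2)[of r] that by auto
    then show ?thesis using False that s(1) \<epsilon>(1) by (auto simp: S_def)
  qed (use inside that in auto)
  have cs_eq: "norm (c s) = R"
  proof (rule antisym[OF _ cs])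
    \<comment> \<open>The curve is inside the ball just before s, so its norm at s is a limit from
      the left of values below R.\<close>
    have "((\<lambda>r. norm (c r)) \<longlongrightarrow> norm (c s)) (at s)"
      using has_vector_derivative_continuous[OF cder] by (intro tendsto_norm) (simp add: isCont_def)
    then have lim: "((\<lambda>r. norm (c r)) \<longlongrightarrow> norm (c s)) (at_left s)"
      using tendsto_mono[OF at_le[of "{..<s}" UNIV s]] by blast
    have "\<forall>\<^sub>F r in at_left s. norm (c r) \<le> R"
      using eventually_at_left_real[OF s_pos] by eventually_elim (use before in force)
    from tendsto_upperbound[OF lim this] show "norm (c s) \<le> R" by simp
  qed
  have norm_\<theta>: "norm (\<theta> s) = 1"
    using frozen_solution_norm_eq[OF sol, of 0 s] c0 zv cs by simp
  \<comment> \<open>Were the direction at s inward or tangential, the line traced backward from the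
    exit point would stay outside the ball; the geodesic would follow it, contrary to being inside
    before s.\<close>
  have outward: "\<theta> s \<bullet> c s > 0"
  proof (rule ccontr)
    assume neg: "\<not> \<theta> s \<bullet> c s > 0"
    have "norm (c s + (r - s) *\<^sub>R \<theta> s) \<ge> R" if "r \<in> closed_segment s (s / 2)" for r
    proof -
      have "(r - s) * (c s \<bullet> \<theta> s) \<ge> 0"
        using neg that s_pos by (intro mult_nonpos_nonpos) (auto simp: closed_segment_eq_real_ivl inner_commute split: if_splits)
      from norm_outgoing_le[OF this] show ?thesis using cs by linarith
    qed
    note line = this
    from frozen_solution_straight(1)[OF sol line] have "norm (c (s / 2)) \<ge> R"
      using line[of "s / 2"] by simp
    then show False using before[of "s / 2"] s_pos by simp
  qed
  have "geodesic (g t) c u \<and> c 0 = z \<and> g t z *v u 0 = v \<and> s > 0 \<and>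
      (\<forall>r\<in>{0<..<s}. c r \<in> ball 0 R) \<and> c s \<notin> ball 0 R \<and> c s = c s \<and> g t (c s) *v u s = \<theta> s"
    using geo c0 gu[of 0] gu[of s] s_pos before cs by simp
  moreover have "(t, c s, \<theta> s) \<in> boundary_out R T"
    using t cs_eq norm_\<theta> outward by (simp add: boundary_out_def)
  ultimately have "((t, z, v), (t, c s, \<theta> s)) \<in> truncated_scattering g R T"
    using b unfolding truncated_scattering_def by blast
  then show ?thesis using that by blast
qed

end

lemma radial_mem_onec_boundary: "norm v = 1 \<Longrightarrow> (v, radial W) \<in> onec_boundary"
  using norm_radial_less[of W] by (simp add: onec_boundary_def onec_bundle_def less_imp_le)

text \<open>A line determined by its direction and foot meets the sphere in at most two points with
  opposite components along v; the sign condition selects one.\<close>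

lemma outgoing_point_unique:
  fixes z w v :: "'a::real_inner"
  assumes "perp z v = perp w v" "norm v = 1" "norm z = norm w" "v \<bullet> z > 0" "v \<bullet> w > 0"
  shows "z = w"
proof -
  have dec: "(norm x)\<^sup>2 = (norm (perp x v))\<^sup>2 + (v \<bullet> x)\<^sup>2" for x
    using norm_add_orthogonal[OF perp_inner[OF assms(2)] assms(2), of x "v \<bullet> x"]
    by (simp add: perp_def inner_commute)
  have "(v \<bullet> z)\<^sup>2 = (v \<bullet> w)\<^sup>2" using dec[of z] dec[of w] assms by simp
  then have "v \<bullet> z = v \<bullet> w" using assms by (simp add: power2_eq_iff)
  then show ?thesis using assms(1) by (simp add: perp_def inner_commute)
qed

text \<open>Totality of the relation of \<open>g2\<close> gives some image of the same entry point.
  Both images are encoded in the extended map at one common boundary point, and equality there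
  identifies exit direction and outgoing line, hence the exit point.\<close>

lemma truncated_scattering_subset:
  fixes g1 g2 :: "real \<Rightarrow> real ^ 'n \<Rightarrow> real ^ 'n ^ 'n"
  assumes "smooth_metric_family g1" and "smooth_metric_family g2"
    and "flat_outside g1 R T" and "flat_outside g2 R T"
    and nt: "\<And>t. nontrapping (g2 t)"
    and ext: "\<And>b. b \<in> onec_boundary \<Longrightarrow> classical_map_ext g1 b = classical_map_ext g2 b"
  shows "truncated_scattering g1 R T \<subseteq> truncated_scattering g2 R T"
proof
  fix x assume x: "x \<in> truncated_scattering g1 R T"
  then obtain t z v z' v' where xe: "x = ((t, z, v), (t, z', v'))"
    and b: "(t, z, v) \<in> boundary_in R T" and o1: "(t, z', v') \<in> boundary_out R T"
    unfolding truncated_scattering_def by blast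
  have zv: "norm z = R" "norm v = 1" "v \<bullet> z < 0" using b by (auto simp: boundary_in_def)
  \<comment> \<open>Positivity of R comes from the element under consideration: it supplies a
    nonzero z of norm R.\<close>
  then have "R > 0" by (metis inner_zero_right less_irrefl zero_less_norm_iff)
  then interpret g1: flat_family g1 R T using assms by unfold_locales
  interpret g2: flat_family g2 R T using assms \<open>R > 0\<close> by unfold_locales
  obtain z'' v'' where x2: "((t, z, v), (t, z'', v'')) \<in> truncated_scattering g2 R T"
    using g2.truncated_scattering_total[OF b nt] by blast
  then have o2: "(t, z'', v'') \<in> boundary_out R T" unfolding truncated_scattering_def by blast
  have eq: "(v', radial ((2 * t) *\<^sub>R v' - perp z' v')) = (v'', radial ((2 * t) *\<^sub>R v'' - perp z'' v''))"
    using g1.truncated_scattering_imp_ext[OF x[unfolded xe]] g2.truncated_scattering_imp_ext[OF x2]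
      ext[OF radial_mem_onec_boundary[OF zv(2)]] by metis
  then have "v'' = v'" "perp z' v' = perp z'' v'" using radial_inj by fastforce+
  moreover have "z' = z''"
    by (rule outgoing_point_unique[of _ v']) (use calculation o1 o2 in \<open>auto simp: boundary_out_def\<close>)
  ultimately show "x \<in> truncated_scattering g2 R T" using x2 xe by simp
qed

theorem proposition9p1:
  fixes g1 g2 :: "real \<Rightarrow> real ^ 'n \<Rightarrow> real ^ 'n ^ 'n"
    and R T :: real
  assumes "smooth_metric_family g1" and "smooth_metric_family g2"
    and "flat_outside g1 R T" and "flat_outside g2 R T"
    and "\<And>t. nontrapping (g1 t)" and "\<And>t. nontrapping (g2 t)"
    and "\<And>b. b \<in> onec_boundary \<Longrightarrow> classical_map_ext g1 b = classical_map_ext g2 b"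
  shows "truncated_scattering g1 R T = truncated_scattering g2 R T"
  using assms by (intro equalityI truncated_scattering_subset) simp_all

end
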